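(* Let $p_{9,3}(n)$ be defined by $\sum_{n\ge0}p_{9,3}(n)q^n=\frac{1}{E_1^3E_9^3}$. Let $m(i,j)$ and $c(j,k)$ be the integer matrices defined below. Then for every positive integer $j$, \begin{align*} \sum_{n=0}^{\infty}p_{9,3}\left(3^{2j-1}n+\tfrac{3^{2j-1}+5}{4}\right)q^{n} &=\sum_{l=1}^{\infty}c(2j-1,l)q^{l-1}\frac{E_{3}^{12l-6}}{E_{1}^{12l}},\\ \sum_{n=0}^{\infty}p_{9,3}\left(3^{2j}n+\tfrac{3^{2j+1}+5}{4}\right)q^{n} &=\sum_{l=1}^{\infty}c(2j,l)q^{l-1}\frac{E_{3}^{12l}}{E_{1}^{12l+6}}. \end{align*}
   Context: $E_j=(q^j;q^j)_\infty=\prod_{n\ge1}(1-q^{jn})$. The matrix $\{m(i,j)\}_{i,j\ge1}$ is defined by (with $m(i,j)=0$ for $i\le0$): $m(1,1)=9$, $m(2,1)=6$, $m(3,1)=1$, $m(i,1)=0$ for $i\ge4$, and for $j\ge2$, $m(i,j)=27m(i-1,j-1)+9m(i-2,j-1)+m(i-3,j-1)$. The matrix $\{c(j,k)\}_{j,k\ge1}$ is defined by $c(1,1)=9$, $c(1,k)=0$ for $k\ge2$, and for $j,k\ge1$: $c(j+1,k)=\sum_{i\ge1}c(j,i)m(4i,i+k)$ if $j$ is odd, and $c(j+1,k)=\sum_{i\ge1}c(j,i)m(4i+2,i+k)$ if $j$ is even (finite sums). *)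

theory Defs
  imports "HOL-Analysis.Analysis" "HOL-Computational_Algebra.Formal_Power_Series"
begin

section \<open>Euler products as formal power series\<close>

text \<open>
  All $q$-series are formal power series over the rationals, with \<^term>\<open>fps_X\<close> as $q$.  Limits,
  infinite products and infinite sums refer to the library's ($q$-adic) metric on formal power
  series.
\<close>

definition qE :: "nat \<Rightarrow> rat fps" where
  "qE j = (\<Prod>n. 1 - fps_X ^ (j * Suc n))"

text \<open>The infinite product converges, so that \<^const>\<open>qE\<close> is not an arbitrary value.\<close>

lemma qE_partial_prod_nth:
  fixes j N n :: nat
  assumes "j > 0" "n \<le> N"
  shows "fps_nth (\<Prod>i\<le>N. 1 - fps_X ^ (j * Suc i) :: rat fps) n
       = fps_nth (\<Prod>i\<le>n. 1 - fps_X ^ (j * Suc i)) n"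
  using assms(2)
proof (induction N rule: dec_induct)
  case (step M)
  have "n < j * Suc (Suc M)"
  proof -
    have "1 * Suc (Suc M) \<le> j * Suc (Suc M)"
      using assms(1) by (intro mult_le_mono1) simp
    moreover have "n < Suc (Suc M)" using step.hyps by simp
    ultimately show ?thesis by (simp only: mult_1_left less_le_trans)
  qed
  hence "fps_nth ((\<Prod>i\<le>M. 1 - fps_X ^ (j * Suc i) :: rat fps) * fps_X ^ (j * Suc (Suc M))) n = 0"
    by (simp only: fps_X_power_mult_right_nth if_True)
  hence "fps_nth (\<Prod>i\<le>Suc M. 1 - fps_X ^ (j * Suc i) :: rat fps) n
       = fps_nth (\<Prod>i\<le>M. 1 - fps_X ^ (j * Suc i)) n"
    by (simp only: prod.atMost_Suc right_diff_distrib mult_1_right fps_sub_nth diff_zero)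
  thus ?case using step.IH by (rule trans)
qed (rule refl)

lemma
  assumes "j > 0"
  shows qE_has_prod: "(\<lambda>n. 1 - fps_X ^ (j * Suc n)) has_prod qE j"
    and qE_nth: "fps_nth (qE j) n = fps_nth (\<Prod>i\<le>n. 1 - fps_X ^ (j * Suc i)) n"
proof -
  define F where "F = Abs_fps (\<lambda>n. fps_nth (\<Prod>i\<le>n. 1 - fps_X ^ (j * Suc i) :: rat fps) n)"
  have "(\<lambda>N. \<Prod>i\<le>N. 1 - fps_X ^ (j * Suc i) :: rat fps) \<longlonglongrightarrow> F"
  proof (rule tendsto_fpsI)
    fix n
    show "\<forall>\<^sub>F N in sequentially.
            fps_nth (\<Prod>i\<le>N. 1 - fps_X ^ (j * Suc i) :: rat fps) n = fps_nth F n"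
      using eventually_ge_at_top[of n]
      by eventually_elim (simp only: F_def fps_nth_Abs_fps, rule qE_partial_prod_nth[OF assms])
  qed
  moreover have "F \<noteq> 0"
  proof -
    have "fps_nth F 0 = 1" using assms by (simp add: F_def)
    thus ?thesis by auto
  qed
  ultimately have F: "(\<lambda>n. 1 - fps_X ^ (j * Suc n) :: rat fps) has_prod F"
    by (simp add: has_prod_def raw_has_prod_def)
  hence eq: "qE j = F"
    unfolding qE_def by (rule has_prod_unique [symmetric])
  show "(\<lambda>n. 1 - fps_X ^ (j * Suc n)) has_prod qE j"
    using F eq by simp
  show "fps_nth (qE j) n = fps_nth (\<Prod>i\<le>n. 1 - fps_X ^ (j * Suc i)) n"
    by (simp add: eq F_def)
qed

definition p93 :: "nat \<Rightarrow> rat" where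
  "p93 n = fps_nth (1 / (qE 1 ^ 3 * qE 9 ^ 3)) n"


section \<open>The coefficient matrices\<close>

text \<open>
  The row index of \<open>m\<close> is an integer, since the recursion refers to rows $i - 3 \le 0$.
  Only columns $j \ge 1$ are meaningful; column \<open>0\<close> is a dummy.
\<close>

fun m :: "int \<Rightarrow> nat \<Rightarrow> int" where
  "m i 0 = 0"
| "m i (Suc 0) = (if i = 1 then 9 else if i = 2 then 6 else if i = 3 then 1 else 0)"
| "m i (Suc (Suc j)) =
     (if i \<le> 0 then 0
      else 27 * m (i - 1) (Suc j) + 9 * m (i - 2) (Suc j) + m (i - 3) (Suc j))"

lemma m_eq_0: "i < int j \<or> i > 3 * int j \<Longrightarrow> m i j = 0"
  by (induction i j rule: m.induct) auto

text \<open>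
  Only indices $j, k \ge 1$ are meaningful; row \<open>0\<close> is a dummy.  The sums over all $i \ge 1$
  are written as sums over their support, which is finite by the lemmas below.
\<close>

fun c :: "nat \<Rightarrow> nat \<Rightarrow> int" where
  "c 0 k = 0"
| "c (Suc 0) k = (if k = 1 then 9 else 0)"
| "c (Suc (Suc j)) k =
     (if odd (Suc j)
      then \<Sum>i | i \<ge> 1 \<and> c (Suc j) i * m (4 * int i) (i + k) \<noteq> 0.
             c (Suc j) i * m (4 * int i) (i + k)
      else \<Sum>i | i \<ge> 1 \<and> c (Suc j) i * m (4 * int i + 2) (i + k) \<noteq> 0.
             c (Suc j) i * m (4 * int i + 2) (i + k))"

lemma c_support_odd: "{i. i \<ge> 1 \<and> c j i * m (4 * int i) (i + k) \<noteq> 0} \<subseteq> {1..3 * k}"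
proof (intro subsetI)
  fix i assume i: "i \<in> {i. i \<ge> 1 \<and> c j i * m (4 * int i) (i + k) \<noteq> 0}"
  hence "m (4 * int i) (i + k) \<noteq> 0" by auto
  hence "\<not> 4 * int i > 3 * int (i + k)" using m_eq_0 by blast
  thus "i \<in> {1..3 * k}" using i by auto
qed

lemma c_support_even: "{i. i \<ge> 1 \<and> c j i * m (4 * int i + 2) (i + k) \<noteq> 0} \<subseteq> {1..3 * k}"
proof (intro subsetI)
  fix i assume i: "i \<in> {i. i \<ge> 1 \<and> c j i * m (4 * int i + 2) (i + k) \<noteq> 0}"
  hence "m (4 * int i + 2) (i + k) \<noteq> 0" by auto
  hence "\<not> 4 * int i + 2 > 3 * int (i + k)" using m_eq_0 by blast
  thus "i \<in> {1..3 * k}" using i by auto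
qed

lemma c_rec_odd:
  "odd j \<Longrightarrow> c (Suc j) k = (\<Sum>i = 1..3 * k. c j i * m (4 * int i) (i + k))"
proof -
  assume j: "odd j"
  then obtain j' where "j = Suc j'" by (cases j) auto
  hence "c (Suc j) k = (\<Sum>i | i \<ge> 1 \<and> c j i * m (4 * int i) (i + k) \<noteq> 0.
                          c j i * m (4 * int i) (i + k))"
    using j by simp
  also have "\<dots> = (\<Sum>i = 1..3 * k. c j i * m (4 * int i) (i + k))"
    using c_support_odd by (intro sum.mono_neutral_left) auto
  finally show ?thesis .
qed

lemma c_rec_even:
  "even j \<Longrightarrow> j > 0 \<Longrightarrow>
     c (Suc j) k = (\<Sum>i = 1..3 * k. c j i * m (4 * int i + 2) (i + k))"
proof -
  assume j: "even j" "j > 0"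
  then obtain j' where "j = Suc j'" by (cases j) auto
  hence "c (Suc j) k = (\<Sum>i | i \<ge> 1 \<and> c j i * m (4 * int i + 2) (i + k) \<noteq> 0.
                          c j i * m (4 * int i + 2) (i + k))"
    using j by simp
  also have "\<dots> = (\<Sum>i = 1..3 * k. c j i * m (4 * int i + 2) (i + k))"
    using c_support_even by (intro sum.mono_neutral_left) auto
  finally show ?thesis .
qed

end

theory Submission
  imports Defs
begin

text \<open>
  Put \<open>z = q E\<^sub>9\<^sup>3 / E\<^sub>1\<^sup>3\<close> and \<open>t = q E\<^sub>3\<^sup>1\<^sup>2 / E\<^sub>1\<^sup>1\<^sup>2\<close>.  By Jacobi's identity for \<open>E\<^sub>1\<^sup>3\<close>,
  \<open>E\<^sub>1\<^sup>3 = A(q\<^sup>3) - 3 q E\<^sub>9\<^sup>3\<close> for some series \<open>A\<close>.  Multiplying over the three substitutions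
  \<open>q \<mapsto> \<omega>q\<close> with \<open>\<omega>\<^sup>3 = 1\<close> gives \<open>A(q\<^sup>3)\<^sup>3 - 27 q\<^sup>3 E\<^sub>9\<^sup>9 = E\<^sub>3\<^sup>1\<^sup>2 / E\<^sub>9\<^sup>3\<close>, that is,
  \<open>z\<^sup>3 = t(q\<^sup>3) (27 z\<^sup>2 + 9 z + 1)\<close>.  Hence the operator that keeps every third coefficient maps
  \<open>z\<^sup>i\<close> to \<open>\<Sum>\<^sub>j m(i, j) t\<^sup>j\<close>.  As \<open>t(q\<^sup>3) t = z\<^sup>4\<close>, this determines its action on the products
  on the right-hand sides, and the two identities follow from each other in turn.
\<close>

section \<open>A finite form of Jacobi's identity\<close>

text \<open>The Gaussian binomial coefficient, given by its Pascal rule instead of a quotient so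
  that it makes sense over every commutative ring, in particular over polynomials and power
  series.\<close>

fun qbinom :: "'a::comm_ring_1 \<Rightarrow> nat \<Rightarrow> nat \<Rightarrow> 'a" where
  "qbinom q N 0 = 1"
| "qbinom q 0 (Suc k) = 0"
| "qbinom q (Suc N) (Suc k) = qbinom q N (Suc k) + q ^ (N - k) * qbinom q N k"

lemma qbinom_eq_0: "N < k \<Longrightarrow> qbinom q N k = 0"
  by (induction q N k rule: qbinom.induct) auto

definition qpoch :: "'a::comm_ring_1 \<Rightarrow> nat \<Rightarrow> 'a" where
  "qpoch q n = (\<Prod>i<n. 1 - q ^ Suc i)"

lemma qpoch_0 [simp]: "qpoch q 0 = 1"
  and qpoch_Suc: "qpoch q (Suc n) = qpoch q n * (1 - q ^ Suc n)"
  by (simp_all add: qpoch_def)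

text \<open>The quotient formula with denominators cleared. The Pascal rule yields it because
  \<open>(1 - q^(d+1)) + q^(d+1) (1 - q^(k+1)) = 1 - q^(N+1)\<close> for
  \<open>N = k + d + 1\<close>.\<close>

lemma qbinom_mult_qpoch:
  "k \<le> N \<Longrightarrow> qbinom q N k * qpoch q k * qpoch q (N - k) = qpoch q N"
proof (induction q N k rule: qbinom.induct)
  case (3 q N k)
  show ?case
  proof (cases "k = N")
    case True
    then show ?thesis using "3.IH"(2) by (simp add: qbinom_eq_0 qpoch_Suc flip: mult.assoc)
  next
    case False
    then have k: "k < N" using 3 by simp
    then obtain d where d: "N = Suc (k + d)" using less_iff_Suc_add by auto
    have 1: "qbinom q N (Suc k) * qpoch q (Suc k) * qpoch q d = qpoch q N"
      using "3.IH"(1) d by simp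
    have 2: "qbinom q N k * qpoch q k * (qpoch q d * (1 - q ^ Suc d)) = qpoch q N"
      using "3.IH"(2) d by (simp add: qpoch_Suc)
    have "qbinom q (Suc N) (Suc k) * qpoch q (Suc k) * qpoch q (Suc N - Suc k)
        = (qbinom q N (Suc k) + q ^ Suc d * qbinom q N k) * qpoch q (Suc k) * qpoch q (Suc d)"
      by (simp add: d)
    also have "\<dots> = (qbinom q N (Suc k) * qpoch q (Suc k) * qpoch q d) * (1 - q ^ Suc d)
          + q ^ Suc d * (1 - q ^ Suc k) * (qbinom q N k * qpoch q k * (qpoch q d * (1 - q ^ Suc d)))"
      unfolding qpoch_Suc by (simp only: algebra_simps)
    also have "\<dots> = qpoch q N * (1 - q ^ Suc d) + q ^ Suc d * (1 - q ^ Suc k) * qpoch q N"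
      unfolding 1 2 ..
    also have "\<dots> = qpoch q N * (1 - q ^ Suc d * q ^ Suc k)"
      by (simp only: algebra_simps mult_1_left)
    also have "q ^ Suc d * q ^ Suc k = q ^ Suc N"
      by (simp add: d power_add mult_ac)
    finally show ?thesis by (simp add: qpoch_Suc)
  qed
qed auto

text \<open>The homogeneous form avoids dividing by \<open>y\<close>, which later becomes a power of
  \<open>q\<close>. Splitting off the last factor \<open>y + x * q ^ N\<close> reproduces the Pascal
  rule in each coefficient.\<close>

lemma q_binomial:
  fixes q x y :: "'a::comm_ring_1"
  shows "(\<Prod>i<N. y + x * q ^ i) = (\<Sum>k\<le>N. q ^ (k choose 2) * qbinom q N k * x ^ k * y ^ (N - k))"
proof (induction N)
  case (Suc N)
  let ?T = "\<lambda>k. q ^ (k choose 2) * qbinom q N k * x ^ k"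
  have *: "(\<Sum>k\<le>N. ?T k * y ^ (Suc N - k)) = (\<Sum>k\<le>Suc N. ?T k * y ^ (Suc N - k))"
    by (simp add: qbinom_eq_0)
  have "(\<Prod>i<Suc N. y + x * q ^ i) = (\<Sum>k\<le>N. ?T k * y ^ (N - k)) * (y + x * q ^ N)"
    by (simp add: Suc)
  also have "\<dots> = (\<Sum>k\<le>N. ?T k * y ^ (Suc N - k)) + (\<Sum>k\<le>N. ?T k * y ^ (N - k) * x * q ^ N)"
    by (simp add: distrib_left sum_distrib_right Suc_diff_le mult.assoc power_Suc2 del: power_Suc)
  also have "\<dots> = y ^ Suc N + (\<Sum>k\<le>N. ?T (Suc k) * y ^ (N - k) + ?T k * y ^ (N - k) * x * q ^ N)"
    unfolding * sum.atMost_Suc_shift by (simp add: sum.distrib binomial_eq_0)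
  also have "\<dots> = y ^ Suc N + (\<Sum>k\<le>N. q ^ (Suc k choose 2) * qbinom q (Suc N) (Suc k) * x ^ Suc k * y ^ (N - k))"
  proof (intro arg_cong2[where f = "(+)"] sum.cong refl)
    fix k assume "k \<in> {..N}"
    then have "q ^ N = q ^ k * q ^ (N - k)" by (simp flip: power_add)
    moreover have "Suc k choose 2 = (k choose 2) + k"
      by (simp add: numeral_2_eq_2)
    ultimately show "?T (Suc k) * y ^ (N - k) + ?T k * y ^ (N - k) * x * q ^ N
        = q ^ (Suc k choose 2) * qbinom q (Suc N) (Suc k) * x ^ Suc k * y ^ (N - k)"
      by (simp add: power_add algebra_simps)
  qed
  also have "\<dots> = (\<Sum>k\<le>Suc N. q ^ (k choose 2) * qbinom q (Suc N) k * x ^ k * y ^ (Suc N - k))"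
    unfolding sum.atMost_Suc_shift by (simp add: binomial_eq_0)
  finally show ?case .
qed (simp add: binomial_eq_0)

text \<open>
  Both sides of the \<open>q\<close>-binomial theorem for $\prod_{i \le 2n} (q^n - z q^i)$ are differentiated
  at $z = 1$, where the factor $i = n$ vanishes.
\<close>

lemma q_binomial_deriv:
  fixes q :: "'a::idom"
  shows "- (q ^ n) * (\<Prod>i\<in>{..2*n} - {n}. q ^ n - q ^ i)
       = (\<Sum>k\<le>2*n+1. (-1) ^ k * of_nat k * q ^ (k choose 2) * qbinom q (2*n+1) k * q ^ (n * (2*n+1-k)))"
proof -
  let ?C = "\<lambda>a. [:a:] :: 'a poly"
  have C_pow: "?C a ^ k = ?C (a ^ k)" for a k
    by (induction k) (auto simp: one_pCons)
  define g where "g = (\<Prod>i\<in>{..2*n} - {n}. [:q ^ n, - (q ^ i):])"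
  have C_qbinom: "qbinom (?C a) N k = ?C (qbinom a N k)" for a N k
    by (induction a N k rule: qbinom.induct) (auto simp: one_pCons C_pow)
  have "[:q ^ n, - (q ^ n):] * g = (\<Prod>i\<le>2*n. [:q ^ n, - (q ^ i):])"
    unfolding g_def by (subst (2) prod.remove[of _ n]) auto
  \<comment> \<open>The theorem is used in the polynomial ring with \<open>x = -z\<close>, so powers
    of \<open>q\<close> enter as the constant polynomials \<open>?C\<close>.\<close>
  also have "\<dots> = (\<Prod>i<2*n+1. ?C (q ^ n) + [:0, -1:] * ?C q ^ i)"
    by (intro prod.cong) (auto simp: C_pow)
  also have "\<dots> = (\<Sum>k\<le>2*n+1. [:q ^ (k choose 2) * qbinom q (2*n+1) k * q ^ (n * (2*n+1-k)):] * [:0, -1:] ^ k)"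
    unfolding q_binomial by (intro sum.cong) (auto simp: C_pow C_qbinom power_mult mult_ac)
  finally have "poly (pderiv ([:q ^ n, - (q ^ n):] * g)) 1
     = poly (pderiv (\<Sum>k\<le>2*n+1. [:q ^ (k choose 2) * qbinom q (2*n+1) k * q ^ (n * (2*n+1-k)):] * [:0, -1:] ^ k)) 1"
    by simp
  moreover have "poly (pderiv ([:q ^ n, - (q ^ n):] * g)) 1 = - (q ^ n) * poly g 1"
    by (subst pderiv_mult) (simp add: pderiv_pCons)
  moreover have "poly g 1 = (\<Prod>i\<in>{..2*n} - {n}. q ^ n - q ^ i)"
    by (simp add: g_def poly_prod)
  moreover have "poly (pderiv ([:a:] * [:0, -1:] ^ k)) 1 = (-1) ^ k * of_nat k * a" for a :: 'a and k
  proof -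
    have "poly (pderiv ([:0, -1:] ^ k)) 1 = (-1) ^ k * (of_nat k :: 'a)"
    proof (cases k)
      case (Suc l)
      then show ?thesis
        by (simp only: pderiv_power_Suc) (simp add: pderiv_pCons del: of_nat_Suc)
    qed simp
    moreover have "[:a:] * [:0, -1:] ^ k = smult a ([:0, -1:] ^ k)" by simp
    ultimately show ?thesis by (simp only: pderiv_smult poly_smult mult_ac)
  qed
  moreover have "pderiv (\<Sum>k\<in>A. f k) = (\<Sum>k\<in>A. pderiv (f k))" for f :: "nat \<Rightarrow> 'a poly" and A
    by (induction A rule: infinite_finite_induct) (auto simp: pderiv_add)
  ultimately show ?thesis
    by (simp only: poly_sum mult.assoc)
qed

lemma choose_two_Suc: "Suc n choose 2 = (n choose 2) + n"
  by (simp add: numeral_2_eq_2)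

lemma choose_two_add: "(a + b) choose 2 = (a choose 2) + (b choose 2) + a * b" for a b :: nat
  by (induction b) (auto simp: choose_two_Suc binomial_eq_0)

lemma choose_two_double: "2 * (j choose 2) + j = j * j" for j :: nat
  by (induction j) (auto simp: choose_two_Suc binomial_eq_0)

text \<open>In \<open>q_binomial_deriv\<close>, the factors below and above \<open>i = n\<close>
  each contribute one \<open>qpoch q n\<close>. On the right, the terms \<open>k = n - j\<close> and
  \<open>k = n + 1 + j\<close> have the same q-binomial and the same power of \<open>q\<close> but
  opposite signs, so their weights combine to \<open>(n + 1 + j) - (n - j) = 2j + 1\<close>. The
  assumptions on \<open>q\<close> permit cancelling powers of \<open>q\<close> and values of
  \<open>qpoch\<close>.\<close>

lemma finite_Jacobi_cube:
  fixes q :: "'a::idom"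
  assumes q: "q \<noteq> 0" "\<And>k. k > 0 \<Longrightarrow> q ^ k \<noteq> 1"
  shows "(qpoch q n)\<^sup>2 = (\<Sum>j\<le>n. (-1) ^ j * of_nat (2*j+1) * q ^ (Suc j choose 2) * qbinom q (2*n+1) (n - j))"
proof -
  let ?N = "2 * n + 1"
  \<comment> \<open>The total exponent of \<open>q\<close> on the left: \<open>n\<close> from the
    prefactor, \<open>n choose 2\<close> from the lower factors, \<open>n * n\<close> from the upper
    ones.\<close>
  define e where "e = n + (n choose 2) + n * n"
  define h where "h k = (-1) ^ k * of_nat k * q ^ (k choose 2) * qbinom q ?N k * q ^ (n * (?N-k))" for k
  have nz: "qpoch q k \<noteq> 0" for k
    using q(2)[of "Suc i" for i] by (simp add: qpoch_def del: power_Suc)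
  have sym: "qbinom q ?N (n + 1 + j) = qbinom q ?N (n - j)" if "j \<le> n" for j
  proof -
    have "qbinom q ?N (n + 1 + j) * qpoch q (n + 1 + j) * qpoch q (n - j)
        = qbinom q ?N (n - j) * qpoch q (n - j) * qpoch q (n + 1 + j)"
      using qbinom_mult_qpoch[of "n + 1 + j" ?N q] qbinom_mult_qpoch[of "n - j" ?N q] that
      by (simp add: mult_2 algebra_simps)
    then show ?thesis using nz by simp
  qed
  have "(\<Prod>i<n. q ^ n - q ^ i) = (\<Prod>i<n. - (q ^ i) * (1 - q ^ (n - i)))"
    by (intro prod.cong refl) (simp add: right_diff_distrib flip: power_add)
  also have "\<dots> = (-1) ^ n * q ^ (n choose 2) * (\<Prod>i<n. 1 - q ^ (n - i))"
  proof -
    have "(\<Prod>i<n. - (q ^ i)) = (-1) ^ n * q ^ (n choose 2)"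
      by (induction n) (auto simp: choose_two_Suc power_add binomial_eq_0)
    then show ?thesis by (simp only: prod.distrib)
  qed
  also have "(\<Prod>i<n. 1 - q ^ (n - i)) = qpoch q n"
    unfolding qpoch_def
    by (rule prod.reindex_bij_witness[of _ "\<lambda>i. n - Suc i" "\<lambda>i. n - Suc i"])
       (auto simp del: power_Suc simp: Suc_diff_Suc)
  finally have 1: "(\<Prod>i<n. q ^ n - q ^ i) = (-1) ^ n * q ^ (n choose 2) * qpoch q n" .
  have "(\<Prod>i\<in>{n+1..2*n}. q ^ n - q ^ i) = (\<Prod>i<n. q ^ n * (1 - q ^ Suc i))"
    by (rule prod.reindex_bij_witness[of _ "\<lambda>i. i + n + 1" "\<lambda>i. i - n - 1"])
       (auto simp: right_diff_distrib simp flip: power_add simp del: power_Suc)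
  also have "\<dots> = q ^ (n * n) * qpoch q n"
    by (simp add: prod.distrib qpoch_def power_mult)
  finally have 2: "(\<Prod>i\<in>{n+1..2*n}. q ^ n - q ^ i) = q ^ (n * n) * qpoch q n" .
  have split: "{..2*n} - {n} = {..<n} \<union> {n+1..2*n}" by auto
  have "(\<Prod>i\<in>{..2*n} - {n}. q ^ n - q ^ i)
      = (\<Prod>i<n. q ^ n - q ^ i) * (\<Prod>i\<in>{n+1..2*n}. q ^ n - q ^ i)"
    unfolding split by (rule prod.union_disjoint) auto
  with q_binomial_deriv[of q n] 1 2
  have "(-1) ^ Suc n * q ^ e * (qpoch q n)\<^sup>2 = (\<Sum>k\<le>?N. h k)"
    by (simp add: e_def h_def power_add power2_eq_square mult_ac)
  also have "\<dots> = (\<Sum>k\<le>n. h k) + (\<Sum>k\<in>{n+1..?N}. h k)"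
  proof -
    have "{..?N} = {..n} \<union> {n+1..?N}" by auto
    then show ?thesis by (simp only:) (subst sum.union_disjoint, auto)
  qed
  also have "(\<Sum>k\<le>n. h k) = (\<Sum>j\<le>n. h (n - j))"
    by (rule sum.reindex_bij_witness[of _ "\<lambda>j. n - j" "\<lambda>j. n - j"]) auto
  also have "(\<Sum>k\<in>{n+1..?N}. h k) = (\<Sum>j\<le>n. h (n + 1 + j))"
    by (rule sum.reindex_bij_witness[of _ "\<lambda>j. n + 1 + j" "\<lambda>k. k - n - 1"]) auto
  also have "(\<Sum>j\<le>n. h (n - j)) + (\<Sum>j\<le>n. h (n + 1 + j))
      = (\<Sum>j\<le>n. (-1) ^ Suc n * q ^ e * ((-1) ^ j * of_nat (2*j+1) * q ^ (Suc j choose 2) * qbinom q ?N (n - j)))"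
    unfolding sum.distrib [symmetric]
  proof (intro sum.cong refl)
    fix j assume "j \<in> {..n}"
    then obtain d where d: "n = j + d" by (auto simp: le_iff_add)
    \<comment> \<open>Both paired exponents equal \<open>e\<close> plus the triangular number of
      \<open>j\<close>.\<close>
    have e1: "((n - j) choose 2) + n * (?N - (n - j)) = e + (Suc j choose 2)"
      using choose_two_double[of j] by (simp add: d e_def choose_two_Suc choose_two_add algebra_simps)
    have e2: "((n + 1 + j) choose 2) + n * (?N - (n + 1 + j)) = e + (Suc j choose 2)"
      using choose_two_double[of j]
      by (simp add: d e_def choose_two_Suc choose_two_add algebra_simps)
    have "h (n - j) = (-1) ^ (n - j) * of_nat (n - j) * qbinom q ?N (n - j) * q ^ (e + (Suc j choose 2))"
      unfolding e1 [symmetric] h_def power_add by (simp only: mult_ac)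
    moreover have "(-1) ^ (n - j) = (-1) ^ n * (-1) ^ j * (1::'a)"
      by (cases "even j"; cases "even d"; simp add: d)
    moreover have "h (n + 1 + j) = (-1) ^ (n + 1 + j) * of_nat (n + 1 + j) * qbinom q ?N (n - j) * q ^ (e + (Suc j choose 2))"
      unfolding e2 [symmetric] h_def power_add using sym[of j] d by (simp only: mult_ac)
    moreover have "of_nat (n + 1 + j) = of_nat (n - j) + (of_nat (2 * j + 1) :: 'a)"
      by (simp add: d)
    ultimately show "h (n - j) + h (n + 1 + j)
        = (-1) ^ Suc n * q ^ e * ((-1) ^ j * of_nat (2*j+1) * q ^ (Suc j choose 2) * qbinom q ?N (n - j))"
      by (simp only: power_add power_Suc power_0 mult_1_left mult_1_right power_one_right) (simp only: algebra_simps mult_minus_left mult_minus_right mult_1_left mult_1_right add_minus_cancel)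
  qed
  also have "\<dots> = (-1) ^ Suc n * q ^ e * (\<Sum>j\<le>n. (-1) ^ j * of_nat (2*j+1) * q ^ (Suc j choose 2) * qbinom q ?N (n - j))"
    by (simp only: sum_distrib_left)
  finally show ?thesis using q(1) by simp
qed

section \<open>Jacobi's identity for the cube of the Euler product\<close>

definition fps_eq_upto :: "nat \<Rightarrow> 'a fps \<Rightarrow> 'a fps \<Rightarrow> bool" where
  "fps_eq_upto n f g \<longleftrightarrow> (\<forall>k<n. fps_nth f k = fps_nth g k)"

lemma fps_eq_upto_refl [simp]: "fps_eq_upto n f f"
  by (simp add: fps_eq_upto_def)

lemma fps_eq_upto_sym: "fps_eq_upto n f g \<Longrightarrow> fps_eq_upto n g f"
  by (simp add: fps_eq_upto_def)

lemma fps_eq_upto_trans [trans]: "fps_eq_upto n f g \<Longrightarrow> fps_eq_upto n g h \<Longrightarrow> fps_eq_upto n f h"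
  by (simp add: fps_eq_upto_def)

lemma fps_eq_upto_mono: "fps_eq_upto n f g \<Longrightarrow> k \<le> n \<Longrightarrow> fps_eq_upto k f g"
  by (simp add: fps_eq_upto_def)

lemma fps_eq_uptoD: "(\<And>n. fps_eq_upto n f g) \<Longrightarrow> f = g"
  by (auto simp: fps_eq_upto_def fps_eq_iff)

lemma fps_eq_upto_add:
  "fps_eq_upto n f f' \<Longrightarrow> fps_eq_upto n g g' \<Longrightarrow> fps_eq_upto n (f + g) (f' + g')"
  by (simp add: fps_eq_upto_def)

lemma fps_eq_upto_diff:
  "fps_eq_upto n f f' \<Longrightarrow> fps_eq_upto n g g' \<Longrightarrow> fps_eq_upto n (f - g) (f' - g')"
  by (simp add: fps_eq_upto_def)

lemma fps_eq_upto_mult: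
  fixes f g :: "'a::semiring_0 fps"
  shows "fps_eq_upto n f f' \<Longrightarrow> fps_eq_upto n g g' \<Longrightarrow> fps_eq_upto n (f * g) (f' * g')"
  by (auto simp: fps_eq_upto_def fps_mult_nth intro!: sum.cong)

lemma fps_eq_upto_power:
  fixes f :: "'a::comm_semiring_1 fps"
  shows "fps_eq_upto n f f' \<Longrightarrow> fps_eq_upto n (f ^ k) (f' ^ k)"
  by (induction k) (auto intro: fps_eq_upto_mult)

lemma fps_eq_upto_sum:
  fixes f :: "'b \<Rightarrow> 'a::comm_monoid_add fps"
  shows "(\<And>x. x \<in> A \<Longrightarrow> fps_eq_upto n (f x) (g x)) \<Longrightarrow> fps_eq_upto n (sum f A) (sum g A)"
  by (induction A rule: infinite_finite_induct) (auto intro: fps_eq_upto_add)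

text \<open>A factor \<open>X^d\<close> gains \<open>d\<close> orders of precision, which makes up
  for the weaker estimates of the q-binomials below.\<close>

lemma fps_eq_upto_X_power_mult:
  fixes f :: "'a::comm_semiring_1 fps"
  shows "fps_eq_upto n f g \<Longrightarrow> fps_eq_upto (d + n) (fps_X ^ d * f) (fps_X ^ d * g)"
  by (auto simp: fps_eq_upto_def fps_X_power_mult_nth)

lemma fps_nth_compose_X_power:
  fixes f :: "'a::comm_ring_1 fps"
  assumes "d > 0"
  shows "fps_nth (f oo fps_X ^ d) n = (if d dvd n then fps_nth f (n div d) else 0)"
proof -
  have "fps_nth (f oo fps_X ^ d) n = (\<Sum>i = 0..n. if n = d * i then fps_nth f i else 0)"
    unfolding fps_compose_nth power_mult [symmetric] fps_X_power_nth by (intro sum.cong) auto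
  also have "\<dots> = (if d dvd n then fps_nth f (n div d) else 0)"
  proof (cases "d dvd n")
    case True
    then obtain k where "n = d * k" by auto
    with assms show ?thesis by (simp add: sum.delta')
  qed (auto intro!: sum.neutral)
  finally show ?thesis .
qed

lemma fps_eq_upto_compose_X_power:
  fixes f :: "'a::comm_ring_1 fps"
  shows "d > 0 \<Longrightarrow> fps_eq_upto n f g \<Longrightarrow> fps_eq_upto n (f oo fps_X ^ d) (g oo fps_X ^ d)"
  by (auto simp: fps_eq_upto_def fps_nth_compose_X_power intro: le_less_trans div_le_dividend)

section \<open>Partial Euler products\<close>

definition qE_part :: "nat \<Rightarrow> nat \<Rightarrow> rat fps" where
  "qE_part j n = (\<Prod>i<n. 1 - fps_X ^ (j * Suc i))"

lemma qE_part_Suc: "qE_part j (Suc n) = qE_part j n * (1 - fps_X ^ (j * Suc n))"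
  and qE_part_0 [simp]: "qE_part j 0 = 1"
  by (simp_all add: qE_part_def)

lemma qE_eq_upto_part:
  assumes "j > 0"
  shows "fps_eq_upto n (qE j) (qE_part j n)"
proof (cases n)
  case (Suc n')
  show ?thesis
    unfolding fps_eq_upto_def
  proof (intro allI impI)
    fix k assume "k < n"
    then have "k \<le> n'" using Suc by simp
    from qE_partial_prod_nth[OF assms this] show "fps_nth (qE j) k = fps_nth (qE_part j n) k"
      by (simp only: qE_nth[OF assms] qE_part_def Suc lessThan_Suc_atMost)
  qed
qed (simp add: fps_eq_upto_def)

lemma qE_nth_0 [simp]: "j > 0 \<Longrightarrow> fps_nth (qE j) 0 = 1"
  by (simp add: qE_nth)

text \<open>The substitution is carried out on the finite products and transferred to the infinite
  ones modulo every \<open>q^n\<close>.\<close>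

lemma qE_mult_eq_compose:
  assumes "d > 0" "j > 0"
  shows "qE (d * j) = qE j oo fps_X ^ d"
proof (rule fps_eq_uptoD)
  fix n
  have "fps_eq_upto n (qE (d * j)) (qE_part (d * j) n)"
    using assms by (intro qE_eq_upto_part) simp
  also have "qE_part (d * j) n = qE_part j n oo fps_X ^ d"
    using assms
    by (simp add: qE_part_def fps_compose_prod_distrib fps_compose_sub_distrib fps_X_power_compose
          mult.assoc flip: power_mult del: mult_Suc_right)
  also have "fps_eq_upto n \<dots> (qE j oo fps_X ^ d)"
    using assms by (intro fps_eq_upto_compose_X_power fps_eq_upto_sym[OF qE_eq_upto_part])
  finally show "fps_eq_upto n (qE (d * j)) (qE j oo fps_X ^ d)" .
qed

text \<open>The terms of Jacobi's series for \<open>E_1^3\<close>; the exponent is the triangular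
  number \<open>j (j + 1) / 2\<close>.\<close>

definition Jacobi_term :: "nat \<Rightarrow> rat fps" where
  "Jacobi_term j = (-1) ^ j * of_nat (2*j+1) * fps_X ^ (Suc j choose 2)"

text \<open>The finite identity is multiplied by \<open>E_1\<close>. Each q-binomial times
  \<open>E_1\<close> is 1 modulo \<open>X^(n-j)\<close>, and the triangular exponent, being at least
  \<open>j\<close>, restores the missing precision.\<close>

lemma Jacobi_cube: "fps_eq_upto n (qE 1 ^ 3) (\<Sum>j\<le>n. Jacobi_term j)"
proof -
  define p where "p = qpoch (fps_X :: rat fps)"
  have p_eq: "fps_eq_upto k (qE 1) (p l)" if "k \<le> l" for k l
    using fps_eq_upto_mono[OF qE_eq_upto_part[of 1 l] that]
    by (simp add: p_def qE_part_def qpoch_def)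
  have X_power: "fps_X ^ k \<noteq> (1 :: rat fps)" if "k > 0" for k
    using that by (auto simp: fps_eq_iff intro!: exI[of _ 0])
  \<comment> \<open>After one more factor \<open>E_1\<close>, both copies of \<open>E_1\<close> can
    be traded for the Pochhammer products in the quotient formula; the extra factor is then removed
    by its inverse.\<close>
  have qbinom_eq: "fps_eq_upto (n - j) (qbinom fps_X (2*n+1) (n - j) * qE 1) 1" if "j \<le> n" for j
  proof -
    let ?B = "qbinom (fps_X :: rat fps) (2*n+1) (n - j)"
    have "fps_eq_upto (n - j) (?B * qE 1 * qE 1) (?B * p (n - j) * p (2*n+1 - (n - j)))"
      by (intro fps_eq_upto_mult fps_eq_upto_refl p_eq) auto
    also have "\<dots> = p (2*n+1)"
      unfolding p_def by (intro qbinom_mult_qpoch) auto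
    also have "fps_eq_upto (n - j) \<dots> (qE 1)"
      by (intro fps_eq_upto_sym[OF p_eq]) auto
    finally have "fps_eq_upto (n - j) (?B * qE 1 * qE 1) (qE 1)" .
    from fps_eq_upto_mult[OF this fps_eq_upto_refl[of _ "inverse (qE 1)"]]
    show ?thesis by (simp add: mult.assoc inverse_mult_eq_1')
  qed
  have "fps_eq_upto n (qE 1 ^ 2 * qE 1) (p n ^ 2 * qE 1)"
    by (intro fps_eq_upto_mult fps_eq_upto_power fps_eq_upto_refl p_eq) auto
  also have "p n ^ 2 * qE 1 = (\<Sum>j\<le>n. (-1) ^ j * of_nat (2*j+1) * (fps_X ^ (Suc j choose 2) * (qbinom fps_X (2*n+1) (n - j) * qE 1)))"
    unfolding p_def by (subst finite_Jacobi_cube) (auto simp: X_power sum_distrib_right mult.assoc)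
  also have "fps_eq_upto n \<dots> (\<Sum>j\<le>n. (-1) ^ j * of_nat (2*j+1) * (fps_X ^ (Suc j choose 2) * 1))"
  proof (rule fps_eq_upto_sum, rule fps_eq_upto_mult[OF fps_eq_upto_refl])
    fix j assume "j \<in> {..n}"
    then have "n \<le> (Suc j choose 2) + (n - j)" by (simp add: choose_two_Suc)
    moreover have "fps_eq_upto ((Suc j choose 2) + (n - j))
        (fps_X ^ (Suc j choose 2) * (qbinom fps_X (2*n+1) (n - j) * qE 1)) (fps_X ^ (Suc j choose 2) * 1)"
      using \<open>j \<in> {..n}\<close> by (intro fps_eq_upto_X_power_mult qbinom_eq) auto
    ultimately show "fps_eq_upto n (fps_X ^ (Suc j choose 2) * (qbinom fps_X (2*n+1) (n - j) * qE 1)) (fps_X ^ (Suc j choose 2) * 1)"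
      using fps_eq_upto_mono by blast
  qed
  finally show ?thesis by (simp add: Jacobi_term_def power2_eq_square power3_eq_cube)
qed

section \<open>Three-dissection of the cube of the Euler product\<close>

definition on_residue :: "nat \<Rightarrow> 'a::zero fps \<Rightarrow> bool" where
  "on_residue r f \<longleftrightarrow> (\<forall>n. n mod 3 \<noteq> r \<longrightarrow> fps_nth f n = 0)"

lemma on_residue_0 [simp]: "on_residue r 0"
  by (simp add: on_residue_def)

lemma on_residue_1 [simp]: "on_residue 0 1"
  by (simp add: on_residue_def)

lemma on_residue_minus: "on_residue r f \<Longrightarrow> on_residue r (- f)" for f :: "'a::group_add fps"
  by (simp add: on_residue_def)

lemma on_residue_add: "on_residue r f \<Longrightarrow> on_residue r g \<Longrightarrow> on_residue r (f + g)"
  for f :: "'a::monoid_add fps"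
  by (simp add: on_residue_def)

lemma on_residue_mult:
  fixes f g :: "'a::semiring_0 fps"
  assumes "on_residue r f" "on_residue s g"
  shows "on_residue ((r + s) mod 3) (f * g)"
  unfolding on_residue_def
proof (intro allI impI)
  fix n :: nat
  assume n: "n mod 3 \<noteq> (r + s) mod 3"
  have "fps_nth f i * fps_nth g (n - i) = 0" if "i \<in> {0..n}" for i
  proof (rule ccontr)
    assume "fps_nth f i * fps_nth g (n - i) \<noteq> 0"
    then have "i mod 3 = r" "(n - i) mod 3 = s"
      using assms by (force simp: on_residue_def)+
    then have "(r + s) mod 3 = (i + (n - i)) mod 3" by (metis mod_add_eq)
    then show False using n that by simp
  qed
  then show "fps_nth (f * g) n = 0" by (simp add: fps_mult_nth)
qed

lemma on_residue_X_power: "on_residue (k mod 3) (fps_X ^ k :: 'a::semiring_1 fps)"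
  by (auto simp: on_residue_def)

lemma on_residue_compose: "on_residue 0 (f oo fps_X ^ 3)" for f :: "'a::comm_ring_1 fps"
  by (auto simp: on_residue_def fps_nth_compose_X_power mod_eq_0_iff_dvd)

definition residue_part :: "nat \<Rightarrow> 'a::zero fps \<Rightarrow> 'a fps" where
  "residue_part r f = Abs_fps (\<lambda>n. if n mod 3 = r then fps_nth f n else 0)"

lemma on_residue_residue_part: "on_residue r (residue_part r f)"
  by (simp add: on_residue_def residue_part_def)

lemma residue_part_sum: "f = residue_part 0 f + residue_part 1 f + residue_part 2 f" for f :: "'a::monoid_add fps"
proof (rule fps_ext)
  fix n :: nat
  have "n mod 3 = 0 \<or> n mod 3 = 1 \<or> n mod 3 = 2" by linarith
  then show "fps_nth f n = fps_nth (residue_part 0 f + residue_part 1 f + residue_part 2 f) n"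
    by (auto simp: residue_part_def)
qed

text \<open>
  The product of \<open>f(q)\<close>, \<open>f(\<omega>q)\<close> and \<open>f(\<omega>\<^sup>2q)\<close> for a primitive cube root of unity \<open>\<omega>\<close>, in terms
  of the residue parts of \<open>f\<close>.
\<close>

definition norm3 :: "'a::comm_ring_1 fps \<Rightarrow> 'a fps" where
  "norm3 f = residue_part 0 f ^ 3 + residue_part 1 f ^ 3 + residue_part 2 f ^ 3
     - 3 * residue_part 0 f * residue_part 1 f * residue_part 2 f"

text \<open>Residue parts are unique, so the norm can be read off from any decomposition by residue
  class.\<close>

lemma norm3_eq:
  fixes a b c :: "'a::comm_ring_1 fps"
  assumes "on_residue 0 a" "on_residue 1 b" "on_residue 2 c"
  shows "norm3 (a + b + c) = a ^ 3 + b ^ 3 + c ^ 3 - 3 * a * b * c"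
proof -
  have "residue_part 0 (a + b + c) = a" "residue_part 1 (a + b + c) = b" "residue_part 2 (a + b + c) = c"
    using assms by (auto simp: fps_eq_iff residue_part_def on_residue_def)
  then show ?thesis by (simp add: norm3_def)
qed

text \<open>The parts of a product are the cyclic convolutions of the parts of the factors, and
  \<open>a^3 + b^3 + c^3 - 3abc\<close>, the circulant determinant, is multiplicative. No root of
  unity has to be adjoined.\<close>

lemma norm3_mult: "norm3 (f * g) = norm3 f * norm3 g" for f g :: "'a::idom fps"
proof -
  define a b c where "a = residue_part 0 f" "b = residue_part 1 f" "c = residue_part 2 f"
  define a' b' c' where "a' = residue_part 0 g" "b' = residue_part 1 g" "c' = residue_part 2 g"
  note defs = a_b_c_def a'_b'_c'_def
  have f: "on_residue 0 a" "on_residue 1 b" "on_residue 2 c"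
   and g: "on_residue 0 a'" "on_residue 1 b'" "on_residue 2 c'"
    by (simp_all add: defs on_residue_residue_part)
  have "f * g = (a + b + c) * (a' + b' + c')"
    unfolding defs residue_part_sum [symmetric] ..
  also have "\<dots> = (a*a' + b*c' + c*b') + (a*b' + b*a' + c*c') + (a*c' + c*a' + b*b')"
    by (simp add: algebra_simps)
  also have "norm3 \<dots> = (a*a' + b*c' + c*b') ^ 3 + (a*b' + b*a' + c*c') ^ 3 + (a*c' + c*a' + b*b') ^ 3
      - 3 * (a*a' + b*c' + c*b') * (a*b' + b*a' + c*c') * (a*c' + c*a' + b*b')"
  proof (rule norm3_eq)
    show "on_residue 0 (a*a' + b*c' + c*b')"
      using on_residue_mult[OF f(1) g(1)] on_residue_mult[OF f(2) g(3)] on_residue_mult[OF f(3) g(2)]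
      by (simp add: on_residue_add)
    show "on_residue 1 (a*b' + b*a' + c*c')"
      using on_residue_mult[OF f(1) g(2)] on_residue_mult[OF f(2) g(1)] on_residue_mult[OF f(3) g(3)]
      by (simp add: on_residue_add)
    show "on_residue 2 (a*c' + c*a' + b*b')"
      using on_residue_mult[OF f(1) g(3)] on_residue_mult[OF f(3) g(1)] on_residue_mult[OF f(2) g(2)]
      by (simp add: on_residue_add numeral_2_eq_2)
  qed
  also have "\<dots> = (a ^ 3 + b ^ 3 + c ^ 3 - 3 * a * b * c) * (a' ^ 3 + b' ^ 3 + c' ^ 3 - 3 * a' * b' * c')"
    by algebra
  also have "\<dots> = norm3 f * norm3 g"
    by (simp only: norm3_def defs)
  finally show ?thesis .
qed

lemma norm3_1 [simp]: "norm3 1 = 1"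
  using norm3_eq[of 1 0 0] by simp

lemma norm3_power: "norm3 (f ^ n) = norm3 f ^ n" for f :: "'a::idom fps"
  by (induction n) (auto simp: norm3_mult)

lemma fps_eq_upto_norm3:
  assumes "fps_eq_upto n f g"
  shows "fps_eq_upto n (norm3 f) (norm3 g)"
proof -
  have "fps_eq_upto n (residue_part r f) (residue_part r g)" for r
    using assms by (simp add: fps_eq_upto_def residue_part_def)
  then show ?thesis
    unfolding norm3_def
    by (intro fps_eq_upto_diff fps_eq_upto_add fps_eq_upto_mult fps_eq_upto_power fps_eq_upto_refl) auto
qed

section \<open>The norm of the Euler product\<close>

lemma norm3_one_minus_X_power:
  "norm3 (1 - fps_X ^ k :: 'a::comm_ring_1 fps) = (if 3 dvd k then (1 - fps_X ^ k) ^ 3 else 1 - fps_X ^ (3 * k))"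
proof -
  let ?X = "- (fps_X ^ k) :: 'a fps"
  have X: "on_residue (k mod 3) ?X"
    by (intro on_residue_minus on_residue_X_power)
  have cube: "?X ^ 3 = - (fps_X ^ (3 * k))"
    by (simp add: power_mult mult.commute[of 3] power3_eq_cube)
  consider "k mod 3 = 0" | "k mod 3 = 1" | "k mod 3 = 2" by linarith
  then show ?thesis
  proof cases
    case 1
    then show ?thesis
      using X on_residue_add[OF on_residue_1, of ?X] norm3_eq[of "1 + ?X" 0 0] by auto
  next
    case 2
    then show ?thesis using X norm3_eq[of 1 ?X 0] cube by (simp add: mod_0_imp_dvd dvd_eq_mod_eq_0)
  next
    case 3
    then show ?thesis using X norm3_eq[of 1 0 ?X] cube by (simp add: dvd_eq_mod_eq_0)
  qed
qed

text \<open>Factors with exponent prime to 3 have norm \<open>1 - X^(3k)\<close>; the others are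
  cubed and form \<open>qE_part 3 M ^ 3\<close>. The factor \<open>qE_part 9 M\<close> supplies the
  \<open>1 - X^(3k)\<close> with \<open>3 dvd k\<close> that are still missing from
  \<open>qE_part 3 (3 * M)\<close>.\<close>

lemma norm3_qE_part:
  "norm3 (qE_part 1 (3 * M)) * qE_part 9 M = qE_part 3 (3 * M) * qE_part 3 M ^ 3"
proof (induction M)
  case (Suc M)
  have 1: "qE_part j (3 * Suc M) = qE_part j (3 * M) * (1 - fps_X ^ (j * (3*M+1)))
      * (1 - fps_X ^ (j * (3*M+2))) * (1 - fps_X ^ (j * (3*M+3)))" for j
    by (simp add: qE_part_Suc eval_nat_numeral)
  have "\<not> 3 dvd 3 * M + 1" "\<not> 3 dvd 3 * M + 2" "3 dvd 3 * M + 3" by presburger+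
  then have "norm3 (qE_part 1 (3 * Suc M)) = norm3 (qE_part 1 (3 * M)) * (1 - fps_X ^ (3 * (3*M+1)))
      * (1 - fps_X ^ (3 * (3*M+2))) * (1 - fps_X ^ (3 * Suc M)) ^ 3"
    unfolding 1 norm3_mult norm3_one_minus_X_power mult_1_left by (simp add: algebra_simps)
  moreover have "qE_part 9 (Suc M) = qE_part 9 M * (1 - fps_X ^ (3 * (3*M+3)))"
    by (simp add: qE_part_Suc algebra_simps)
  ultimately have "norm3 (qE_part 1 (3 * Suc M)) * qE_part 9 (Suc M)
      = (norm3 (qE_part 1 (3 * M)) * qE_part 9 M) * ((1 - fps_X ^ (3 * (3*M+1))) * (1 - fps_X ^ (3 * (3*M+2)))
        * (1 - fps_X ^ (3 * (3*M+3))) * (1 - fps_X ^ (3 * Suc M)) ^ 3)"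
    by (simp only: mult_ac)
  also have "\<dots> = qE_part 3 (3 * Suc M) * qE_part 3 (Suc M) ^ 3"
    unfolding Suc 1[of 3] qE_part_Suc[of 3 M] power_mult_distrib by (simp only: mult_ac)
  finally show ?case .
qed simp

lemma norm3_qE: "norm3 (qE 1) * qE 9 = qE 3 ^ 4"
proof (rule fps_eq_uptoD)
  fix n
  have part: "fps_eq_upto n (qE j) (qE_part j M)" if "n \<le> M" "j > 0" for j M
    using fps_eq_upto_mono qE_eq_upto_part that by blast
  have "fps_eq_upto n (norm3 (qE 1) * qE 9) (norm3 (qE_part 1 (3 * n)) * qE_part 9 n)"
    by (intro fps_eq_upto_mult fps_eq_upto_norm3 part) auto
  also have "\<dots> = qE_part 3 (3 * n) * qE_part 3 n ^ 3"
    by (rule norm3_qE_part)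
  also have "fps_eq_upto n \<dots> (qE 3 * qE 3 ^ 3)"
    by (intro fps_eq_upto_sym[OF fps_eq_upto_mult] fps_eq_upto_power part) auto
  finally show "fps_eq_upto n (norm3 (qE 1) * qE 9) (qE 3 ^ 4)"
    by (simp add: numeral_eq_Suc)
qed

section \<open>Jacobi's series modulo 3\<close>

lemma Jacobi_term_residue:
  "on_residue 0 (Jacobi_term (3 * k))"
  "on_residue 0 (Jacobi_term (3 * k + 2))"
  "Jacobi_term (3 * k + 1) = - 3 * fps_X * (Jacobi_term k oo fps_X ^ 9)"
proof -
  have const: "Jacobi_term j = fps_const ((-1) ^ j * of_nat (2*j+1)) * fps_X ^ (Suc j choose 2)" for j
    unfolding Jacobi_term_def
    by (simp flip: fps_const_mult fps_const_power fps_const_neg fps_of_nat fps_const_add)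
  have res: "on_residue 0 (Jacobi_term j)" if "3 dvd (Suc j choose 2)" for j
    unfolding const using that on_residue_X_power[of "Suc j choose 2", where 'a = rat]
    by (auto simp: on_residue_def)
  have double: "2 * (k choose 2) + k = k * k" by (rule choose_two_double)
  have 0: "Suc (3 * k) choose 2 = 3 * ((k choose 2) + k * k + k)"
  proof -
    have "3 * k = k + (k + k)" by simp
    then have "3 * k choose 2 = 3 * (k choose 2) + 3 * (k * k)"
      by (simp only: choose_two_add) (simp add: algebra_simps)
    then show ?thesis by (simp add: choose_two_Suc)
  qed
  \<comment> \<open>Self-similarity of triangular numbers: the one of \<open>3k + 1\<close> is nine
    times that of \<open>k\<close>, plus 1. The odd weight \<open>6k + 3\<close> is likewise three
    times \<open>2k + 1\<close>.\<close>
  have 1: "Suc (3 * k + 1) choose 2 = 9 * (Suc k choose 2) + 1"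
    using 0 double by (simp add: choose_two_Suc)
  have 2: "Suc (3 * k + 2) choose 2 = 3 * (3 * (Suc k choose 2) + k + 1)"
    using 1 choose_two_Suc[of "Suc (3 * k + 1)"] by simp
  show "on_residue 0 (Jacobi_term (3 * k))" "on_residue 0 (Jacobi_term (3 * k + 2))"
    using 0 2 by (auto intro!: res)
  have c0: "Jacobi_term k oo fps_X ^ 9 = fps_const ((-1) ^ k * of_nat (2*k+1)) * fps_X ^ (9 * (Suc k choose 2))"
    by (simp add: const fps_compose_mult_distrib fps_X_power_compose power_mult)
  have c1: "(-1) ^ (3 * k + 1) * of_nat (2 * (3 * k + 1) + 1) = - 3 * ((-1) ^ k * of_nat (2*k+1) :: rat)"
    by (simp add: power_mult)
  have c2: "fps_const (- 3 * x) = - 3 * fps_const x" for x :: rat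
    by (simp add: numeral_fps_const flip: fps_const_mult fps_const_neg)
  have c3: "fps_X ^ (9 * (Suc k choose 2) + 1) = fps_X * (fps_X ^ (9 * (Suc k choose 2)) :: rat fps)"
    by simp
  show "Jacobi_term (3 * k + 1) = - 3 * fps_X * (Jacobi_term k oo fps_X ^ 9)"
    unfolding const[of "3 * k + 1"] 1 c0 c1 c2 c3 by (simp only: mult_ac)
qed

lemma Jacobi_sum_residue:
  "\<exists>B. on_residue 0 B \<and> (\<Sum>j<3*M. Jacobi_term j) = B - 3 * fps_X * ((\<Sum>j<M. Jacobi_term j) oo fps_X ^ 9)"
proof (induction M)
  case (Suc M)
  then obtain B where B: "on_residue 0 B"
    "(\<Sum>j<3*M. Jacobi_term j) = B - 3 * fps_X * ((\<Sum>j<M. Jacobi_term j) oo fps_X ^ 9)" by blast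
  have "(\<Sum>j<3 * Suc M. Jacobi_term j) = (\<Sum>j<3*M. Jacobi_term j) + Jacobi_term (3*M) + Jacobi_term (3*M+1) + Jacobi_term (3*M+2)"
    by (simp add: eval_nat_numeral)
  also have "\<dots> = (B + Jacobi_term (3*M) + Jacobi_term (3*M+2)) - 3 * fps_X * ((\<Sum>j<Suc M. Jacobi_term j) oo fps_X ^ 9)"
    unfolding B(2) Jacobi_term_residue(3) by (simp add: fps_compose_add_distrib algebra_simps)
  finally show ?case
    using on_residue_add[OF on_residue_add[OF B(1) Jacobi_term_residue(1)[of M]] Jacobi_term_residue(2)[of M]]
    by blast
qed (auto intro: exI[of _ 0])

text \<open>The terms of Jacobi's series with \<open>j\<close> congruent to 1 modulo 3 reproduce the
  series itself in \<open>q^9\<close>, up to the factor \<open>-3q\<close>; all other terms have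
  exponents divisible by 3.\<close>

lemma qE_1_cube_residue:
  obtains A where "qE 1 ^ 3 = (A oo fps_X ^ 3) - 3 * fps_X * qE 9 ^ 3"
proof
  define A where "A = Abs_fps (\<lambda>n. fps_nth (qE 1 ^ 3) (3 * n))"
  have E9: "qE 9 ^ 3 = (qE 1 ^ 3) oo fps_X ^ 9"
    using qE_mult_eq_compose[of 9 1] by (simp add: fps_compose_power)
  show "qE 1 ^ 3 = (A oo fps_X ^ 3) - 3 * fps_X * qE 9 ^ 3"
  proof (rule fps_ext)
    fix n
    \<comment> \<open>A truncation depending on \<open>n\<close> suffices, since only the
      coefficient at \<open>n\<close> is compared. A multiple of three terms keeps the triples
      complete.\<close>
    obtain B where B: "on_residue 0 B"
      "(\<Sum>j<3*Suc n. Jacobi_term j) = B - 3 * fps_X * ((\<Sum>j<Suc n. Jacobi_term j) oo fps_X ^ 9)"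
      using Jacobi_sum_residue by blast
    have "{..3 * n + 2} = {..<3 * Suc n}" by auto
    then have "fps_eq_upto (3 * n + 2) (qE 1 ^ 3) (\<Sum>j<3*Suc n. Jacobi_term j)"
      using Jacobi_cube[of "3 * n + 2"] by (simp only:)
    moreover have "fps_eq_upto (3 * n + 2) B B" by simp
    moreover have "fps_eq_upto (Suc n) (3 * fps_X * ((\<Sum>j<Suc n. Jacobi_term j) oo fps_X ^ 9)) (3 * fps_X * qE 9 ^ 3)"
    proof -
      have "fps_eq_upto n ((\<Sum>j<Suc n. Jacobi_term j) oo fps_X ^ 9) ((qE 1 ^ 3) oo fps_X ^ 9)"
        using Jacobi_cube[of n]
        by (intro fps_eq_upto_compose_X_power) (auto simp: lessThan_Suc_atMost intro: fps_eq_upto_sym)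
      from fps_eq_upto_mult[OF fps_eq_upto_refl[of _ 3] fps_eq_upto_X_power_mult[OF this, of 1]]
      show ?thesis by (simp add: E9 mult.assoc)
    qed
    ultimately have eq: "fps_nth (qE 1 ^ 3) n = fps_nth B n - fps_nth (3 * fps_X * qE 9 ^ 3) n"
      unfolding B(2) by (simp add: fps_eq_upto_def)
    have X: "fps_nth (3 * fps_X * qE 9 ^ 3) n = 0" if "n mod 3 = 0"
    proof -
      \<comment> \<open>The series \<open>q E_9^3\<close> lives on exponents congruent to 1 modulo
        9, hence never on multiples of 3.\<close>
      have "\<not> 9 dvd (n - 1)" if "n > 0"
        using \<open>n mod 3 = 0\<close> that by presburger
      then show ?thesis
        by (auto simp: E9 fps_nth_compose_X_power numeral_fps_const mult.assoc)
    qed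
    show "fps_nth (qE 1 ^ 3) n = fps_nth ((A oo fps_X ^ 3) - 3 * fps_X * qE 9 ^ 3) n"
    proof (cases "n mod 3 = 0")
      case True
      with X show ?thesis by (auto simp: fps_nth_compose_X_power A_def)
    next
      case False
      then have "fps_nth B n = 0" using B(1) by (simp add: on_residue_def)
      with False eq show ?thesis by (simp add: fps_nth_compose_X_power dvd_eq_mod_eq_0)
    qed
  qed
qed

text \<open>The norm of \<open>E_1^3\<close> is computed twice: from its two residue parts, and as
  the cube of \<open>norm3_qE\<close>.\<close>

lemma qE_cubic_relation:
  obtains A where "qE 1 ^ 3 = (A oo fps_X ^ 3) - 3 * (fps_X * qE 9 ^ 3)"
    "((A oo fps_X ^ 3) ^ 3 - 27 * (fps_X * qE 9 ^ 3) ^ 3) * qE 9 ^ 3 = qE 3 ^ 12"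
proof -
  obtain A where A: "qE 1 ^ 3 = (A oo fps_X ^ 3) - 3 * (fps_X * qE 9 ^ 3)"
    using qE_1_cube_residue by (auto simp: mult.assoc)
  have E9: "3 * qE 9 ^ 3 = (3 * qE 3 ^ 3) oo fps_X ^ 3"
    using qE_mult_eq_compose[of 3 3] by (simp add: fps_compose_power fps_compose_mult_distrib numeral_fps_const)
  have "on_residue 1 (- (3 * (fps_X * qE 9 ^ 3)))"
    using on_residue_mult[OF on_residue_X_power[of 1] on_residue_compose[of "3 * qE 3 ^ 3"]]
    by (intro on_residue_minus) (simp add: mult_ac flip: E9)
  from norm3_eq[OF on_residue_compose this on_residue_0, of A]
  have "norm3 (qE 1 ^ 3) = (A oo fps_X ^ 3) ^ 3 - 27 * (fps_X * qE 9 ^ 3) ^ 3"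
    by (subst A) (simp add: power_mult_distrib)
  moreover have "norm3 (qE 1 ^ 3) * qE 9 ^ 3 = qE 3 ^ 12"
    using arg_cong[OF norm3_qE, of "\<lambda>x. x ^ 3"] by (simp add: norm3_power power_mult_distrib flip: power_mult)
  ultimately show ?thesis using A that by simp
qed

section \<open>The operator that keeps every third coefficient\<close>

text \<open>Known for modular forms as the operator \<open>U_3\<close>.\<close>

definition thirds :: "'a::zero fps \<Rightarrow> 'a fps" where
  "thirds f = Abs_fps (\<lambda>n. fps_nth f (3 * n))"

lemma thirds_add: "thirds (f + g) = thirds f + thirds g"
  by (simp add: thirds_def fps_eq_iff)

lemma thirds_sum: "thirds (sum f A) = (\<Sum>x\<in>A. thirds (f x))"
  by (induction A rule: infinite_finite_induct) (auto simp: thirds_add, auto simp: thirds_def fps_eq_iff)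

lemma thirds_of_int_mult: "thirds (of_int k * f) = of_int k * thirds f" for f :: "'a::comm_ring_1 fps"
  by (simp add: thirds_def fps_eq_iff)

lemma thirds_numeral_mult: "thirds (numeral k * f) = numeral k * thirds f" for f :: "'a::comm_ring_1 fps"
  by (simp add: thirds_def fps_eq_iff numeral_fps_const)

text \<open>Linearity over series in \<open>q^3\<close>: in the convolution at \<open>3n\<close>
  only indices divisible by 3 contribute.\<close>

lemma thirds_mult_compose:
  fixes f g :: "'a::comm_ring_1 fps"
  shows "thirds ((f oo fps_X ^ 3) * g) = f * thirds g"
proof (rule fps_ext)
  fix n
  have "fps_nth (thirds ((f oo fps_X ^ 3) * g)) n
      = (\<Sum>i\<in>{0..3*n}. if 3 dvd i then fps_nth f (i div 3) * fps_nth g (3 * n - i) else 0)"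
    by (simp add: thirds_def fps_mult_nth fps_nth_compose_X_power if_distrib[of "\<lambda>x. x * _"] cong: if_cong)
  also have "\<dots> = (\<Sum>i\<in>{i\<in>{0..3*n}. 3 dvd i}. fps_nth f (i div 3) * fps_nth g (3 * n - i))"
    by (subst sum.inter_filter [symmetric]) auto
  also have "\<dots> = (\<Sum>i\<in>{0..n}. fps_nth f i * fps_nth g (3 * (n - i)))"
    by (rule sum.reindex_bij_witness[of _ "\<lambda>i. 3 * i" "\<lambda>i. i div 3"]) (auto simp: right_diff_distrib')
  finally show "fps_nth (thirds ((f oo fps_X ^ 3) * g)) n = fps_nth (f * thirds g) n"
    by (simp add: thirds_def fps_mult_nth)
qed

lemma thirds_compose: "thirds (f oo fps_X ^ 3) = f" for f :: "'a::comm_ring_1 fps"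
  by (simp add: thirds_def fps_eq_iff fps_nth_compose_X_power)

lemma thirds_eq_0: "on_residue r f \<Longrightarrow> r \<noteq> 0 \<Longrightarrow> thirds f = 0"
  by (auto simp: thirds_def fps_eq_iff on_residue_def)

lemma compose_power_X3: "(f oo fps_X ^ 3) ^ k = f ^ k oo fps_X ^ 3" for f :: "rat fps"
  by (simp add: fps_compose_power)

lemma compose_mult_X3: "(f oo fps_X ^ 3) * (g oo fps_X ^ 3) = f * g oo fps_X ^ 3" for f :: "rat fps"
  by (simp add: fps_compose_mult_distrib)

section \<open>The cubic relation between \<open>zq\<close> and \<open>tq\<close>\<close>

definition zq :: "rat fps" where
  "zq = fps_X * qE 9 ^ 3 * inverse (qE 1) ^ 3"

definition tq :: "rat fps" where
  "tq = fps_X * qE 3 ^ 12 * inverse (qE 1) ^ 12"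

lemma qE_inverse: "j > 0 \<Longrightarrow> qE j * inverse (qE j) = 1"
  by (simp add: inverse_mult_eq_1')

lemma qE_compose_3: "qE 1 oo fps_X ^ 3 = qE 3" "qE 3 oo fps_X ^ 3 = qE 9"
  using qE_mult_eq_compose[of 3 1] qE_mult_eq_compose[of 3 3] by simp_all

lemma inverse_qE_compose_3: "inverse (qE 1) oo fps_X ^ 3 = inverse (qE 3)"
  by (simp add: fps_inverse_compose flip: qE_compose_3)

lemma tq_compose: "tq oo fps_X ^ 3 = fps_X ^ 3 * qE 9 ^ 12 * inverse (qE 3) ^ 12"
  by (simp add: tq_def fps_compose_mult_distrib qE_compose_3 inverse_qE_compose_3 flip: fps_compose_power del: One_nat_def)

text \<open>The powers of \<open>E_3\<close> cancel. Since \<open>thirds\<close> pulls out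
  \<open>tq oo fps_X ^ 3\<close>, its action on powers of \<open>tq\<close> reduces to powers of
  \<open>zq\<close>.\<close>

lemma tq_compose_mult_tq: "(tq oo fps_X ^ 3) * tq = zq ^ 4"
proof -
  have X4: "fps_X ^ 4 = fps_X * (fps_X ^ 3 :: rat fps)"
    by (simp flip: power_Suc)
  have "(tq oo fps_X ^ 3) * tq
      = (fps_X ^ 3 * qE 9 ^ 12 * inverse (qE 3) ^ 12) * (fps_X * qE 3 ^ 12 * inverse (qE 1) ^ 12)"
    by (simp only: tq_compose) (simp only: tq_def)
  also have "\<dots> = fps_X ^ 4 * qE 9 ^ 12 * inverse (qE 1) ^ 12 * (qE 3 * inverse (qE 3)) ^ 12"
    unfolding power_mult_distrib X4 by (simp only: mult_ac)
  also have "\<dots> = zq ^ 4"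
    by (simp add: qE_inverse zq_def power_mult_distrib flip: power_mult)
  finally show ?thesis .
qed

lemma zq_power_rec: "zq ^ Suc (Suc (Suc i)) = (tq oo fps_X ^ 3) * (27 * zq ^ Suc (Suc i) + 9 * zq ^ Suc i + zq ^ i)"
  and thirds_zq: "thirds zq = 9 * tq"
  and thirds_zq_sq: "thirds (zq ^ 2) = 6 * tq + 243 * tq ^ 2"
proof -
  obtain A where A: "qE 1 ^ 3 = (A oo fps_X ^ 3) - 3 * (fps_X * qE 9 ^ 3)"
    "((A oo fps_X ^ 3) ^ 3 - 27 * (fps_X * qE 9 ^ 3) ^ 3) * qE 9 ^ 3 = qE 3 ^ 12"
    using qE_cubic_relation by blast
  define u D a v t i3 e9 where "u = qE 1 ^ 3" "D = fps_X * qE 9 ^ 3" "a = (A oo fps_X ^ 3)"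
    "v = inverse (qE 1) ^ 3" "t = (tq oo fps_X ^ 3)" "i3 = inverse (qE 3) ^ 12" "e9 = qE 9 ^ 3"
  note defs = this
  have uv: "u * v = 1"
    unfolding defs power_mult_distrib [symmetric] by (simp add: qE_inverse)
  have z: "zq = D * v" by (simp add: zq_def defs mult.assoc)
  have a: "a = u + 3 * D" using A(1) by (simp add: defs)
  have "(a ^ 3 - 27 * D ^ 3) * e9 * i3 = 1"
    using A(2) by (simp add: defs qE_inverse flip: power_mult_distrib)
  \<comment> \<open>As \<open>a = u + 3D\<close>, the norm \<open>a^3 - 27D^3\<close> is divisible
    by \<open>u\<close>, so this equation expresses \<open>1/u\<close> polynomially.\<close>
  then have N: "(u ^ 3 + 9 * D * u ^ 2 + 27 * D ^ 2 * u) * e9 * i3 = 1"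
    unfolding a by algebra
  have t: "t = D ^ 3 * e9 * i3"
    unfolding defs tq_compose power_mult_distrib by (simp add: mult.assoc flip: power_mult power_add)
  have cubic: "zq ^ 3 = t * (27 * zq ^ 2 + 9 * zq + 1)"
    using uv N unfolding z t by algebra
  show "zq ^ Suc (Suc (Suc i)) = (tq oo fps_X ^ 3) * (27 * zq ^ Suc (Suc i) + 9 * zq ^ Suc i + zq ^ i)"
    using arg_cong[OF cubic, of "\<lambda>x. x * zq ^ i"]
    by (simp add: defs algebra_simps power3_eq_cube power2_eq_square)
  \<comment> \<open>Here \<open>1/u\<close> is replaced by
    \<open>e9 * i3 * (a^2 + 3aD + 9D^2)\<close>. The three summands lie in the residue classes 1, 2
    and 0, so \<open>thirds\<close> keeps only \<open>9 * t\<close>.\<close>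
  have z1: "zq = e9 * i3 * a ^ 2 * D + 3 * (e9 * i3 * a * D ^ 2) + 9 * t"
    using uv N unfolding z t a by algebra
  \<comment> \<open>The square is not split completely: the last summand contains \<open>zq\<close>
    again, whose image under \<open>thirds\<close> is already known.\<close>
  have z2: "zq ^ 2 = e9 * i3 * a * D ^ 2 + 6 * t + 27 * t * zq"
    using uv N unfolding z t a by algebra
  have i3: "i3 = inverse (qE 1) ^ 12 oo fps_X ^ 3" and e9: "e9 = qE 3 ^ 3 oo fps_X ^ 3"
    by (simp_all add: defs qE_compose_3 inverse_qE_compose_3 flip: fps_compose_power del: One_nat_def)
  have e9i3: "on_residue 0 (e9 * i3)"
    unfolding i3 e9 compose_mult_X3 by (rule on_residue_compose)
  have D: "on_residue 1 D"
    using on_residue_mult[OF on_residue_X_power[of 1] on_residue_compose[of "qE 3 ^ 3"]]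
    by (simp add: defs qE_compose_3 flip: fps_compose_power)
  have D2: "on_residue 2 (D ^ 2)"
    using on_residue_mult[OF D D] by (simp add: power2_eq_square numeral_2_eq_2)
  have a_res: "on_residue 0 a" "on_residue 0 (a ^ 2)"
    unfolding defs compose_power_X3 by (rule on_residue_compose)+
  have 1: "on_residue 1 (e9 * i3 * a ^ 2 * D)"
    using on_residue_mult[OF on_residue_mult[OF e9i3 a_res(2)] D] by simp
  have 2: "on_residue 2 (e9 * i3 * a * D ^ 2)"
    using on_residue_mult[OF on_residue_mult[OF e9i3 a_res(1)] D2] by (simp add: numeral_2_eq_2)
  show z1': "thirds zq = 9 * tq"
    using thirds_eq_0[OF 1] thirds_eq_0[OF 2]
    by (subst z1) (simp add: thirds_add thirds_numeral_mult defs thirds_compose)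
  have "thirds (27 * t * zq) = 27 * (tq * thirds zq)"
    unfolding defs mult.assoc thirds_numeral_mult thirds_mult_compose ..
  then show "thirds (zq ^ 2) = 6 * tq + 243 * tq ^ 2"
    using thirds_eq_0[OF 2]
    by (subst z2) (simp add: thirds_add thirds_numeral_mult defs thirds_compose z1' power2_eq_square)
qed

lemma m_nonpos: "i \<le> 0 \<Longrightarrow> m i j = 0"
  by (induction i j rule: m.induct) auto

text \<open>The cubic relation gives the images of the powers of \<open>zq\<close> the recursion
  that defines \<open>m\<close>. Any bound \<open>K\<close> from \<open>i\<close> on is allowed,
  because row \<open>i\<close> of \<open>m\<close> vanishes beyond column \<open>i\<close>.\<close>

lemma thirds_zq_power:
  "i > 0 \<Longrightarrow> i \<le> K \<Longrightarrow> thirds (zq ^ i) = (\<Sum>j=1..K. of_int (m (int i) j) * tq ^ j)"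
proof (induction i arbitrary: K rule: less_induct)
  case (less i)
  then obtain K' where K: "K = Suc K'" by (cases K) auto
  \<comment> \<open>The range ends one earlier than \<open>K\<close>, as the recursion pulls out one
    factor \<open>tq\<close>.\<close>
  define S where "S k = (\<Sum>j=1..K'. of_int (m k j) * tq ^ j)" for k
  have S0: "S k = 0" if "k \<le> 0" for k
    using that by (simp add: S_def m_nonpos)
  have "(\<Sum>j=1..K. of_int (m (int i) j) * tq ^ j)
     = of_int (m (int i) 1) * tq + (\<Sum>j=1..K'. of_int (m (int i) (Suc j)) * tq ^ Suc j)"
  proof -
    have "sum g {1..Suc K'} = g 1 + (\<Sum>j=1..K'. g (Suc j))" for g :: "nat \<Rightarrow> rat fps"
      by (induction K') (auto simp: add.assoc)
    then show ?thesis unfolding K by (simp only: power_one_right)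
  qed
  also have "(\<Sum>j=1..K'. of_int (m (int i) (Suc j)) * tq ^ Suc j)
     = (\<Sum>j=1..K'. (27 * of_int (m (int i - 1) j) + 9 * of_int (m (int i - 2) j) + of_int (m (int i - 3) j)) * tq ^ Suc j)"
  proof (intro sum.cong refl)
    fix j assume "j \<in> {1..K'}"
    then obtain j' where "j = Suc j'" by (cases j) auto
    then show "of_int (m (int i) (Suc j)) * tq ^ Suc j
        = (27 * of_int (m (int i - 1) j) + 9 * of_int (m (int i - 2) j) + of_int (m (int i - 3) j)) * tq ^ Suc j"
      using less.prems by simp
  qed
  also have "\<dots> = tq * (27 * S (int i - 1) + 9 * S (int i - 2) + S (int i - 3))"
    by (simp add: S_def sum_distrib_left sum.distrib algebra_simps)
  finally have rec: "(\<Sum>j=1..K. of_int (m (int i) j) * tq ^ j)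
     = of_int (m (int i) 1) * tq + tq * (27 * S (int i - 1) + 9 * S (int i - 2) + S (int i - 3))" .
  have IH: "thirds (zq ^ l) = S (int l)" if "0 < l" "l < i" for l
    unfolding S_def using less.IH[of l K'] less.prems that K by simp
  have "i = 1 \<or> i = 2 \<or> (\<exists>l. i = Suc (Suc (Suc l)))"
    using less.prems by presburger
  then consider "i = 1" | "i = 2" | l where "i = Suc (Suc (Suc l))" by blast
  then show ?case
  proof cases
    case 1
    then show ?thesis unfolding rec by (simp add: S0 thirds_zq)
  next
    case 2
    have "S 1 = 9 * tq" using IH[of 1] 2 by (simp add: thirds_zq)
    with 2 show ?thesis unfolding rec by (simp add: S0 thirds_zq_sq[unfolded power2_eq_square] power2_eq_square algebra_simps)
  next
    case (3 l)
    have "thirds (zq ^ i) = tq * (27 * thirds (zq ^ Suc (Suc l)) + 9 * thirds (zq ^ Suc l) + thirds (zq ^ l))"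
      unfolding 3 zq_power_rec thirds_mult_compose thirds_add thirds_numeral_mult ..
    also have "thirds (zq ^ Suc (Suc l)) = S (int i - 1)"
      using 3 by (subst IH) (simp_all add: algebra_simps)
    also have "thirds (zq ^ Suc l) = S (int i - 2)"
      using 3 by (subst IH) (simp_all add: algebra_simps)
    finally have *: "thirds (zq ^ i) = tq * (27 * S (int i - 1) + 9 * S (int i - 2) + thirds (zq ^ l))" .
    show ?thesis
    proof (cases "l = 0")
      \<comment> \<open>For \<open>i = 3\<close> the recursion reaches \<open>zq ^ 0\<close>, whose
        image is 1 while \<open>S 0 = 0\<close>; the entry \<open>m 3 1 = 1\<close> accounts for the
        difference.\<close>
      case True
      have "thirds 1 = (1 :: rat fps)" by (simp add: thirds_def fps_eq_iff)
      with True 3 show ?thesis unfolding rec * by (simp add: S0 algebra_simps)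
    next
      case False
      then have "thirds (zq ^ l) = S (int i - 3)"
        using 3 by (subst IH) simp_all
      with False 3 show ?thesis unfolding rec * by simp
    qed
  qed
qed

section \<open>Iteration\<close>

text \<open>Multiplied by \<open>q\<close>, the terms \<open>odd_term l\<close> and
  \<open>even_term l\<close> become \<open>tq ^ l\<close> divided by \<open>E_3^6\<close> and by
  \<open>E_1^6\<close>, respectively, for \<open>l \<ge> 1\<close>.\<close>

definition odd_term :: "nat \<Rightarrow> rat fps" where
  "odd_term l = fps_X ^ (l - 1) * (qE 3 ^ (12 * l - 6) / qE 1 ^ (12 * l))"

definition even_term :: "nat \<Rightarrow> rat fps" where
  "even_term l = fps_X ^ (l - 1) * (qE 3 ^ (12 * l) / qE 1 ^ (12 * l + 6))"

lemma fps_divide_qE_power: "j > 0 \<Longrightarrow> f / qE j ^ n = f * inverse (qE j) ^ n"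
  by (simp add: fps_divide_unit fps_inverse_power)

lemma tq_power: "tq ^ l = fps_X ^ l * qE 3 ^ (12 * l) * inverse (qE 1) ^ (12 * l)"
  by (simp add: tq_def power_mult_distrib power_mult)

lemma odd_term_tq:
  assumes "l \<ge> 1"
  shows "qE 3 ^ 6 * (fps_X * odd_term l) = tq ^ l"
proof -
  have "qE 3 ^ 6 * (fps_X * odd_term l)
      = (fps_X * fps_X ^ (l - 1)) * (qE 3 ^ 6 * qE 3 ^ (12 * l - 6)) * inverse (qE 1) ^ (12 * l)"
    by (simp add: odd_term_def fps_divide_qE_power mult_ac del: One_nat_def)
  also have "\<dots> = tq ^ l"
    using assms by (simp add: tq_power del: power_Suc flip: power_Suc power_add)
  finally show ?thesis .
qed

lemma even_term_tq:
  assumes "l \<ge> 1"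
  shows "qE 1 ^ 6 * (fps_X * even_term l) = tq ^ l"
proof -
  have "qE 1 ^ 6 * (fps_X * even_term l)
      = (fps_X * fps_X ^ (l - 1)) * qE 3 ^ (12 * l) * inverse (qE 1) ^ (12 * l) * (qE 1 * inverse (qE 1)) ^ 6"
    unfolding even_term_def fps_divide_qE_power[OF zero_less_one]
    by (simp only: power_add power_mult_distrib mult_ac)
  also have "\<dots> = tq ^ l"
    using assms by (simp add: tq_power qE_inverse del: power_Suc flip: power_Suc)
  finally show ?thesis .
qed

lemma qE_nonzero [simp]: "j > 0 \<Longrightarrow> qE j \<noteq> 0"
  using qE_nth_0[of j] by (metis fps_zero_nth zero_neq_one)

lemma inverse_qE_nonzero [simp]: "j > 0 \<Longrightarrow> inverse (qE j) \<noteq> 0"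
  using qE_inverse[of j] by force

lemma tq_nonzero [simp]: "tq \<noteq> 0"
  by (simp add: tq_def)

text \<open>Columns up to \<open>l\<close> vanish in row \<open>i\<close> because
  \<open>i > 3l\<close>, so \<open>tq ^ l\<close> can be factored out.\<close>

lemma thirds_zq_power_shift:
  assumes "i > 0" "int i \<le> int (l + K)" "int i > 3 * int l"
  shows "thirds (zq ^ i) = tq ^ l * (\<Sum>k=1..K. of_int (m (int i) (l + k)) * tq ^ k)"
proof -
  have "thirds (zq ^ i) = (\<Sum>j=1..l + K. of_int (m (int i) j) * tq ^ j)"
    using assms by (intro thirds_zq_power) auto
  also have "\<dots> = (\<Sum>j\<in>{l+1..l + K}. of_int (m (int i) j) * tq ^ j)"
    using assms by (intro sum.mono_neutral_right) (auto simp: m_eq_0)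
  also have "\<dots> = (\<Sum>k=1..K. of_int (m (int i) (l + k)) * tq ^ (l + k))"
    by (rule sum.reindex_bij_witness[of _ "\<lambda>k. l + k" "\<lambda>j. j - l"]) auto
  finally show ?thesis
    by (simp add: sum_distrib_left power_add mult_ac)
qed

text \<open>Multiplying by \<open>tq ^ l\<close> outside means multiplying by its \<open>q^3\<close>
  version inside, which gives \<open>zq ^ (4 * l)\<close>. The factor \<open>E_3^6\<close> leaves
  \<open>thirds\<close> as \<open>E_1^6\<close>, the normalisation of
  \<open>even_term\<close>.\<close>

lemma thirds_odd_term:
  assumes "l \<ge> 1" "K \<ge> 3 * l"
  shows "thirds (fps_X * odd_term l) = (\<Sum>k=1..K. of_int (m (4 * int l) (l + k)) * (fps_X * even_term k))"
proof -
  have "tq ^ l * thirds (tq ^ l) = thirds ((tq ^ l oo fps_X ^ 3) * tq ^ l)"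
    by (simp add: thirds_mult_compose)
  also have "(tq ^ l oo fps_X ^ 3) * tq ^ l = ((tq oo fps_X ^ 3) * tq) ^ l"
    by (simp only: power_mult_distrib compose_power_X3)
  also have "\<dots> = zq ^ (4 * l)"
    by (simp only: tq_compose_mult_tq power_mult)
  also have "thirds (zq ^ (4 * l)) = tq ^ l * (\<Sum>k=1..K. of_int (m (int (4 * l)) (l + k)) * tq ^ k)"
    using assms by (intro thirds_zq_power_shift) auto
  finally have *: "thirds (tq ^ l) = (\<Sum>k=1..K. of_int (m (4 * int l) (l + k)) * tq ^ k)"
    by simp
  have "qE 1 ^ 6 * thirds (fps_X * odd_term l) = thirds (tq ^ l)"
    unfolding odd_term_tq[OF assms(1), symmetric] qE_compose_3(1)[symmetric] compose_power_X3 thirds_mult_compose ..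
  also have "\<dots> = (\<Sum>k=1..K. of_int (m (4 * int l) (l + k)) * (qE 1 ^ 6 * (fps_X * even_term k)))"
    unfolding * by (intro sum.cong refl arg_cong2[where f = "(*)"] even_term_tq [symmetric]) auto
  also have "\<dots> = qE 1 ^ 6 * (\<Sum>k=1..K. of_int (m (4 * int l) (l + k)) * (fps_X * even_term k))"
    by (simp only: sum_distrib_left mult_ac)
  finally show ?thesis
    by (subst (asm) mult_left_cancel) auto
qed

text \<open>The factor \<open>E_1^(-6)\<close> is absorbed by one additional
  \<open>tq oo fps_X ^ 3\<close>, at the price of two more powers of \<open>zq\<close>; hence the
  row \<open>4l + 2\<close>.\<close>

lemma thirds_even_term:
  assumes "l \<ge> 1" "K \<ge> 3 * l + 2"
  shows "thirds (even_term l) = (\<Sum>k=1..K. of_int (m (4 * int l + 2) (l + k)) * odd_term k)"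
proof -
  \<comment> \<open>Chosen so that \<open>t(q^3) / E_1^6 = q z^2 w(q^3)\<close> and
    \<open>q w E_3^6 = t\<close>; the second relation cancels the additional \<open>tq\<close> at
    the end.\<close>
  define w where "w = qE 3 ^ 6 * inverse (qE 1) ^ 12"
  have w3: "w oo fps_X ^ 3 = qE 9 ^ 6 * inverse (qE 3) ^ 12"
    by (simp add: w_def qE_compose_3 inverse_qE_compose_3 del: One_nat_def
          flip: compose_power_X3 compose_mult_X3)
  have i1: "fps_X * even_term l = tq ^ l * inverse (qE 1) ^ 6"
  proof -
    have "tq ^ l * inverse (qE 1) ^ 6 = (fps_X * even_term l) * (qE 1 * inverse (qE 1)) ^ 6"
      unfolding even_term_tq[OF assms(1), symmetric] power_mult_distrib by (simp only: mult_ac)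
    then show ?thesis by (simp add: qE_inverse)
  qed
  have "fps_X * ((tq oo fps_X ^ 3) ^ Suc l * even_term l)
      = ((tq oo fps_X ^ 3) * tq) ^ l * ((tq oo fps_X ^ 3) * inverse (qE 1) ^ 6)"
    using i1 by (simp add: power_mult_distrib mult_ac)
  also have "\<dots> = zq ^ (4 * l) * (zq ^ 2 * fps_X * (w oo fps_X ^ 3))"
  proof -
    have "(tq oo fps_X ^ 3) * inverse (qE 1) ^ 6 = zq ^ 2 * fps_X * (w oo fps_X ^ 3)"
    proof -
      have "qE 9 ^ 12 = (qE 9 ^ 3)\<^sup>2 * qE 9 ^ 6" "inverse (qE 1) ^ 6 = (inverse (qE 1) ^ 3)\<^sup>2"
        by (simp_all flip: power_mult power_add)
      moreover have "fps_X ^ 3 = fps_X\<^sup>2 * (fps_X :: rat fps)"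
        by (simp add: power2_eq_square power3_eq_cube)
      ultimately show ?thesis
        unfolding w3 tq_compose zq_def power_mult_distrib by (simp only: mult_ac)
    qed
    then show ?thesis by (simp only: tq_compose_mult_tq power_mult)
  qed
  also have "\<dots> = fps_X * ((w oo fps_X ^ 3) * zq ^ (4 * l + 2))"
    by (simp only: power_add mult_ac)
  finally have "(tq ^ Suc l oo fps_X ^ 3) * even_term l = (w oo fps_X ^ 3) * zq ^ (4 * l + 2)"
    unfolding compose_power_X3 by simp
  then have "tq ^ Suc l * thirds (even_term l) = w * thirds (zq ^ (4 * l + 2))"
    by (metis thirds_mult_compose)
  also have "thirds (zq ^ (4 * l + 2)) = tq ^ l * (\<Sum>k=1..K. of_int (m (int (4 * l + 2)) (l + k)) * tq ^ k)"
    using assms by (intro thirds_zq_power_shift) auto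
  finally have "tq ^ l * (tq * thirds (even_term l)) = tq ^ l * (w * (\<Sum>k=1..K. of_int (m (4 * int l + 2) (l + k)) * tq ^ k))"
    by (simp add: mult_ac add_ac)
  then have "tq * thirds (even_term l) = w * (\<Sum>k=1..K. of_int (m (4 * int l + 2) (l + k)) * tq ^ k)"
    by simp
  also have "(\<Sum>k=1..K. of_int (m (4 * int l + 2) (l + k)) * tq ^ k)
      = (\<Sum>k=1..K. of_int (m (4 * int l + 2) (l + k)) * (qE 3 ^ 6 * (fps_X * odd_term k)))"
    by (intro sum.cong refl arg_cong2[where f = "(*)"] odd_term_tq [symmetric]) auto
  also have "w * \<dots> = (w * qE 3 ^ 6 * fps_X) * (\<Sum>k=1..K. of_int (m (4 * int l + 2) (l + k)) * odd_term k)"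
    by (simp only: sum_distrib_left mult_ac)
  also have "w * qE 3 ^ 6 * fps_X = tq"
  proof -
    have "qE 3 ^ 12 = qE 3 ^ 6 * qE 3 ^ 6"
      by (simp flip: power_add)
    then show ?thesis
      unfolding w_def tq_def by (simp only: mult_ac)
  qed
  finally show ?thesis by simp
qed

section \<open>Finite support of the rows of \<open>c\<close>\<close>

text \<open>A crude bound: a nonzero \<open>m\<close> entry in the recursion forces
  \<open>i + k \<le> 4i + 2\<close>, hence \<open>k \<le> 5i\<close>.\<close>

lemma c_eq_0: "j \<ge> 1 \<Longrightarrow> k > 5 ^ j \<Longrightarrow> c j k = 0"
proof (induction j arbitrary: k)
  case (Suc j)
  show ?case
  proof (cases "j = 0")
    case False
    have *: "c j i * m (4 * int i) (i + k) = 0" "c j i * m (4 * int i + 2) (i + k) = 0" if "i \<ge> 1" for i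
    proof -
      consider "i > 5 ^ j" | "i \<le> 5 ^ j" by linarith
      then have "c j i = 0 \<or> m (4 * int i) (i + k) = 0 \<and> m (4 * int i + 2) (i + k) = 0"
      proof cases
        case 1
        then show ?thesis using Suc.IH False by simp
      next
        case 2
        then have "5 * i < k" using Suc.prems by simp
        then show ?thesis using that by (simp add: m_eq_0)
      qed
      then show "c j i * m (4 * int i) (i + k) = 0" "c j i * m (4 * int i + 2) (i + k) = 0" by auto
    qed
    show ?thesis
      using False * by (cases "odd j") (auto simp: c_rec_odd c_rec_even intro!: sum.neutral)
  qed (use Suc.prems in auto)
qed simp

text \<open>The summation range no longer depends on the column \<open>k\<close>, so that double
  sums can be exchanged.\<close>

lemma c_Suc_odd:
  assumes "odd j" "5 ^ j \<le> L"
  shows "c (Suc j) k = (\<Sum>i=1..L. c j i * m (4 * int i) (i + k))"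
proof -
  have "j \<ge> 1" using assms by (cases j) auto
  then have "(\<Sum>i=1..3 * k. c j i * m (4 * int i) (i + k)) = (\<Sum>i=1..L. c j i * m (4 * int i) (i + k))"
    using assms(2) by (intro sum.mono_neutral_cong) (auto simp: c_eq_0 m_eq_0)
  then show ?thesis using c_rec_odd[OF assms(1)] by simp
qed

lemma c_Suc_even:
  assumes "even j" "j > 0" "5 ^ j \<le> L"
  shows "c (Suc j) k = (\<Sum>i=1..L. c j i * m (4 * int i + 2) (i + k))"
proof -
  have "(\<Sum>i=1..3 * k. c j i * m (4 * int i + 2) (i + k)) = (\<Sum>i=1..L. c j i * m (4 * int i + 2) (i + k))"
    using assms(2,3) by (intro sum.mono_neutral_cong) (auto simp: c_eq_0 m_eq_0)
  then show ?thesis using c_rec_even[OF assms(1,2)] by simp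
qed

section \<open>Generating functions along the arithmetic progressions\<close>

text \<open>The division by 4 is exact, since odd powers of 3 are 3 modulo 4.\<close>

definition p93_odd :: "nat \<Rightarrow> rat fps" where
  "p93_odd j = Abs_fps (\<lambda>n. p93 (3 ^ (2 * j - 1) * n + (3 ^ (2 * j - 1) + 5) div 4))"

definition p93_even :: "nat \<Rightarrow> rat fps" where
  "p93_even j = Abs_fps (\<lambda>n. p93 (3 ^ (2 * j) * n + (3 ^ (2 * j + 1) + 5) div 4))"

lemma thirds_X_mult: "thirds (fps_X * Abs_fps f) = fps_X * Abs_fps (\<lambda>n. f (3 * n + 2))"
  for f :: "nat \<Rightarrow> 'a::comm_ring_1"
proof (rule fps_ext)
  fix n
  show "fps_nth (thirds (fps_X * Abs_fps f)) n = fps_nth (fps_X * Abs_fps (\<lambda>n. f (3 * n + 2))) n"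
    by (cases n) (auto simp: thirds_def)
qed

text \<open>The factor \<open>q\<close> makes \<open>thirds\<close> select the indices
  \<open>3n + 2\<close>, and \<open>2q + (q + 5)/4 = (9q + 5)/4\<close> for
  \<open>q = 3^(2j-1)\<close> matches the offsets.\<close>

lemma p93_even_eq_thirds:
  assumes "j \<ge> 1"
  shows "fps_X * p93_even j = thirds (fps_X * p93_odd j)"
proof -
  define q :: nat where "q = 3 ^ (2 * j - 1)"
  obtain i where "j = Suc i" using assms by (cases j) auto
  then have q: "3 ^ (2 * j) = 3 * q" "3 ^ (2 * j + 1) = 9 * q"
    by (simp_all add: q_def)
  have "q * (3 * n + 2) + (q + 5) div 4 = 3 * q * n + (9 * q + 5) div 4" for n
    by (simp add: algebra_simps)
  then show ?thesis
    unfolding p93_even_def p93_odd_def thirds_X_mult q q_def [symmetric] by (simp only:)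
qed

text \<open>Both progressions have the same offset, so no shift by \<open>q\<close> occurs
  here.\<close>

lemma p93_odd_Suc_eq_thirds: "p93_odd (Suc j) = thirds (p93_even j)"
  by (simp add: p93_odd_def p93_even_def thirds_def fps_eq_iff mult_ac)

text \<open>Here \<open>q / (E_1^3 E_9^3) = zq / E_9^6\<close>, and \<open>E_9^6\<close> is a series
  in \<open>q^3\<close>; \<open>thirds_zq\<close> then supplies the initial entry 9 of
  \<open>c\<close>.\<close>

lemma p93_odd_1: "p93_odd 1 = 9 * odd_term 1"
proof -
  have "fps_X * p93_odd 1 = thirds (fps_X * Abs_fps p93)"
    unfolding p93_odd_def thirds_X_mult by simp
  also have "Abs_fps p93 = inverse (qE 1) ^ 3 * inverse (qE 9) ^ 3"
    by (simp add: fps_eq_iff p93_def fps_divide_unit fps_inverse_mult fps_inverse_power)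
  also have "fps_X * \<dots> = inverse (qE 9) ^ 6 * zq"
  proof -
    have "inverse (qE 9) ^ 6 * zq = fps_X * (inverse (qE 1) ^ 3 * inverse (qE 9) ^ 3) * (qE 9 * inverse (qE 9)) ^ 3"
    proof -
      have "inverse (qE 9) ^ 6 = inverse (qE 9) ^ 3 * inverse (qE 9) ^ 3"
        by (simp flip: power_add)
      then show ?thesis
        unfolding zq_def power_mult_distrib by (simp only: mult_ac)
    qed
    then show ?thesis by (simp add: qE_inverse)
  qed
  also have "inverse (qE 9) ^ 6 = inverse (qE 3) ^ 6 oo fps_X ^ 3"
    by (simp add: fps_inverse_compose qE_compose_3 flip: compose_power_X3)
  also have "thirds ((inverse (qE 3) ^ 6 oo fps_X ^ 3) * zq) = inverse (qE 3) ^ 6 * (9 * tq)"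
    by (simp only: thirds_mult_compose thirds_zq)
  also have "\<dots> = fps_X * (9 * odd_term 1) * (qE 3 * inverse (qE 3)) ^ 6"
    using odd_term_tq[of 1] unfolding power_mult_distrib by (simp add: mult_ac)
  finally show ?thesis by (simp add: qE_inverse)
qed

lemma p93_even_expansion:
  assumes "j \<ge> 1" "p93_odd j = (\<Sum>l=1..5 ^ (2 * j - 1). of_int (c (2 * j - 1) l) * odd_term l)"
  shows "p93_even j = (\<Sum>l=1..5 ^ (2 * j). of_int (c (2 * j) l) * even_term l)"
proof -
  define L :: nat where "L = 5 ^ (2 * j - 1)"
  define K :: nat where "K = 5 ^ (2 * j)"
  obtain i where i: "j = Suc i" using assms by (cases j) auto
  have K: "K = 5 * L" by (simp add: K_def L_def i)
  have c: "c (2 * j) k = (\<Sum>l=1..L. c (2 * j - 1) l * m (4 * int l) (l + k))" for k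
    using c_Suc_odd[of "2 * j - 1" L k] i by (simp add: L_def)
  have "fps_X * p93_even j = (\<Sum>l=1..L. of_int (c (2 * j - 1) l) * thirds (fps_X * odd_term l))"
    unfolding p93_even_eq_thirds[OF assms(1)] assms(2) L_def [symmetric]
    by (simp only: sum_distrib_left thirds_sum mult.left_commute[of fps_X] thirds_of_int_mult)
  \<comment> \<open>The choice \<open>K = 5 * L\<close> is large enough for every
    \<open>l \<le> L\<close> at once.\<close>
  also have "\<dots> = (\<Sum>l=1..L. \<Sum>k=1..K. of_int (c (2 * j - 1) l * m (4 * int l) (l + k)) * (fps_X * even_term k))"
    using K by (intro sum.cong refl) (simp add: thirds_odd_term[where K = K] sum_distrib_left mult.assoc)
  also have "\<dots> = (\<Sum>k=1..K. of_int (c (2 * j) k) * (fps_X * even_term k))"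
    by (subst sum.swap) (simp only: c of_int_sum sum_distrib_right)
  also have "\<dots> = fps_X * (\<Sum>k=1..K. of_int (c (2 * j) k) * even_term k)"
    by (simp only: sum_distrib_left mult.left_commute[of fps_X])
  finally show ?thesis by (simp add: K_def)
qed

lemma p93_odd_Suc_expansion:
  assumes "j \<ge> 1" "p93_even j = (\<Sum>l=1..5 ^ (2 * j). of_int (c (2 * j) l) * even_term l)"
  shows "p93_odd (Suc j) = (\<Sum>l=1..5 ^ (2 * Suc j - 1). of_int (c (2 * Suc j - 1) l) * odd_term l)"
proof -
  define L :: nat where "L = 5 ^ (2 * j)"
  define K :: nat where "K = 5 ^ (2 * Suc j - 1)"
  have K: "K = 5 * L" by (simp add: K_def L_def)
  have c: "c (2 * Suc j - 1) k = (\<Sum>l=1..L. c (2 * j) l * m (4 * int l + 2) (l + k))" for k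
    using c_Suc_even[of "2 * j" L k] assms(1) by (simp add: L_def)
  have "p93_odd (Suc j) = (\<Sum>l=1..L. of_int (c (2 * j) l) * thirds (even_term l))"
    unfolding p93_odd_Suc_eq_thirds assms(2) L_def [symmetric]
    by (simp only: thirds_sum thirds_of_int_mult)
  also have "\<dots> = (\<Sum>l=1..L. \<Sum>k=1..K. of_int (c (2 * j) l * m (4 * int l + 2) (l + k)) * odd_term k)"
    using K by (intro sum.cong refl) (simp add: thirds_even_term[where K = K] sum_distrib_left mult.assoc)
  also have "\<dots> = (\<Sum>k=1..K. of_int (c (2 * Suc j - 1) k) * odd_term k)"
    by (subst sum.swap) (simp only: c of_int_sum sum_distrib_right)
  finally show ?thesis by (simp add: K_def)
qed

lemma p93_odd_expansion:
  assumes "j \<ge> 1"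
  shows "p93_odd j = (\<Sum>l=1..5 ^ (2 * j - 1). of_int (c (2 * j - 1) l) * odd_term l)"
  using assms
proof (induction j rule: dec_induct)
  case base
  have "(\<Sum>l=1..5. of_int (c 1 l) * odd_term l) = (\<Sum>l\<in>{1}. of_int (c 1 l) * odd_term l)"
    by (intro sum.mono_neutral_right) auto
  then show ?case by (simp add: p93_odd_1[simplified])
next
  case (step j)
  then show ?case by (intro p93_odd_Suc_expansion p93_even_expansion)
qed

theorem theorem3p7:
  fixes j :: nat
  assumes "j \<ge> 1"
  shows
    "((\<lambda>l. of_int (c (2 * j - 1) l) * fps_X ^ (l - 1) * (qE 3 ^ (12 * l - 6) / qE 1 ^ (12 * l)))
        has_sum Abs_fps (\<lambda>n. p93 (3 ^ (2 * j - 1) * n + (3 ^ (2 * j - 1) + 5) div 4))) {1..}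
   \<and> ((\<lambda>l. of_int (c (2 * j) l) * fps_X ^ (l - 1) * (qE 3 ^ (12 * l) / qE 1 ^ (12 * l + 6)))
        has_sum Abs_fps (\<lambda>n. p93 (3 ^ (2 * j) * n + (3 ^ (2 * j + 1) + 5) div 4))) {1..}"
proof
  note odd = p93_odd_expansion[OF assms]
  note even = p93_even_expansion[OF assms odd]
  show "((\<lambda>l. of_int (c (2 * j - 1) l) * fps_X ^ (l - 1) * (qE 3 ^ (12 * l - 6) / qE 1 ^ (12 * l)))
        has_sum Abs_fps (\<lambda>n. p93 (3 ^ (2 * j - 1) * n + (3 ^ (2 * j - 1) + 5) div 4))) {1..}"
    \<comment> \<open>The infinite sum is the finite expansion, as the row of \<open>c\<close>
      vanishes beyond that range.\<close>
    unfolding p93_odd_def [symmetric] odd mult.assoc odd_term_def [symmetric]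
    using assms by (intro has_sum_finite_neutralI[where B = "{1..5 ^ (2 * j - 1)}"]) (auto simp: c_eq_0)
  show "((\<lambda>l. of_int (c (2 * j) l) * fps_X ^ (l - 1) * (qE 3 ^ (12 * l) / qE 1 ^ (12 * l + 6)))
        has_sum Abs_fps (\<lambda>n. p93 (3 ^ (2 * j) * n + (3 ^ (2 * j + 1) + 5) div 4))) {1..}"
    unfolding p93_even_def [symmetric] even mult.assoc even_term_def [symmetric]
    using assms by (intro has_sum_finite_neutralI[where B = "{1..5 ^ (2 * j)}"]) (auto simp: c_eq_0)
qed

end
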